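(* Let $K$ be a field such that some subfield of $K$ is algebraically closed. Then the set $\widetilde{K}$ of arithmetically fixed elements of $K$ is equal to the prime field of $K$.
   Context: Let $K$ be a field and $A\subseteq K$. A map $f:A\to K$ is called arithmetic if: (1) if $1\in A$ then $f(1)=1$; (2) if $a,b\in A$ and $a+b\in A$ then $f(a+b)=f(a)+f(b)$; (3) if $a,b\in A$ and $a\cdot b\in A$ then $f(a\cdot b)=f(a)\cdot f(b)$. An element $r\in K$ is called arithmetically fixed if there is a finite set $A(r)\subseteq K$ with $r\in A(r)$ such that every arithmetic map $f:A(r)\to K$ satisfies $f(r)=r$. The set of arithmetically fixed elements of $K$ is denoted $\widetilde{K}$. *)

theory Defs
  imports "HOL-Algebra.Algebraic_Closure"
begin

definition arithmetic_map :: "('a, 'b) ring_scheme \<Rightarrow> 'a set \<Rightarrow> ('a \<Rightarrow> 'a) \<Rightarrow> bool" where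
  "arithmetic_map K A f \<longleftrightarrow>
     f \<in> A \<rightarrow> carrier K \<and>
     (\<one>\<^bsub>K\<^esub> \<in> A \<longrightarrow> f \<one>\<^bsub>K\<^esub> = \<one>\<^bsub>K\<^esub>) \<and>
     (\<forall>a\<in>A. \<forall>b\<in>A. a \<oplus>\<^bsub>K\<^esub> b \<in> A \<longrightarrow> f (a \<oplus>\<^bsub>K\<^esub> b) = f a \<oplus>\<^bsub>K\<^esub> f b) \<and>
     (\<forall>a\<in>A. \<forall>b\<in>A. a \<otimes>\<^bsub>K\<^esub> b \<in> A \<longrightarrow> f (a \<otimes>\<^bsub>K\<^esub> b) = f a \<otimes>\<^bsub>K\<^esub> f b)"

definition arithmetically_fixed :: "('a, 'b) ring_scheme \<Rightarrow> 'a \<Rightarrow> bool" where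
  "arithmetically_fixed K r \<longleftrightarrow>
     (\<exists>A. finite A \<and> A \<subseteq> carrier K \<and> r \<in> A \<and> (\<forall>f. arithmetic_map K A f \<longrightarrow> f r = r))"

definition fixed_elements :: "('a, 'b) ring_scheme \<Rightarrow> 'a set" where
  "fixed_elements K = {r \<in> carrier K. arithmetically_fixed K r}"

definition prime_field :: "('a, 'b) ring_scheme \<Rightarrow> 'a set" where
  "prime_field K = \<Inter>{F. subfield F K}"

end

theory Submission
  imports Defs "HOL-Computational_Algebra.Primes"
begin

text \<open>
  The fixed elements form a subfield, so they contain the prime field. For the converse, let \<open>r\<close> be
  fixed, with witness \<open>A\<close>. In characteristic \<open>p > 0\<close> the Frobenius map is arithmetic, so \<open>r\<close> is one of
  the at most \<open>p\<close> roots of \<open>X^p - X\<close>, and these are the multiples of \<open>1\<close>. In characteristic \<open>0\<close>, let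
  \<open>k\<close> be the prime field, \<open>F\<close> the algebraically closed subfield, and suppose \<open>r\<close> is not in \<open>k\<close>. Every
  homomorphism \<open>k[r] \<rightarrow> F\<close> that does not annihilate a certain nonzero \<open>c \<in> k[r]\<close> extends to \<open>k[r][A]\<close>,
  hence restricts to an arithmetic map on \<open>A\<close>. There is such a homomorphism moving \<open>r\<close>: if \<open>r\<close> is
  transcendental over \<open>k\<close>, send it to almost any element of \<open>F\<close>; if it is algebraic, send it to
  another root of its minimal polynomial, which exists by separability.
\<close>

subsection \<open>Homomorphisms and polynomials\<close>

text \<open>The image of \<open>h\<close> is \<open>P\<close> modulo the kernel of \<open>h\<close>,
  so \<open>g\<close> descends to it. With \<open>h\<close> the evaluation at an element, this
  builds homomorphisms on the ring generated by that element.\<close>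

lemma ring_hom_factor:
  assumes P: "ring P" and S: "ring S" and L: "ring L"
    and h: "h \<in> ring_hom P S" and g: "g \<in> ring_hom P L"
    and ker: "\<And>p. p \<in> carrier P \<Longrightarrow> h p = \<zero>\<^bsub>S\<^esub> \<Longrightarrow> g p = \<zero>\<^bsub>L\<^esub>"
  obtains k where "k \<in> ring_hom (S\<lparr>carrier := h ` carrier P\<rparr>) L"
    and "\<And>p. p \<in> carrier P \<Longrightarrow> k (h p) = g p"
proof -
  interpret h: ring_hom_ring P S h
    using P S h by (rule ring_hom_ringI2)
  interpret g: ring_hom_ring P L g
    using P L g by (rule ring_hom_ringI2)
  have eq: "g p = g q" if "p \<in> carrier P" "q \<in> carrier P" "h p = h q" for p q
  proof -
    have "h (p \<ominus>\<^bsub>P\<^esub> q) = \<zero>\<^bsub>S\<^esub>"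
      using that by (simp add: a_minus_def h.S.r_neg)
    then have "g p \<ominus>\<^bsub>L\<^esub> g q = \<zero>\<^bsub>L\<^esub>"
      using ker[of "p \<ominus>\<^bsub>P\<^esub> q"] that by (simp add: a_minus_def)
    then show ?thesis
      using that by simp
  qed
  \<comment> \<open>An arbitrary preimage is chosen; \<open>eq\<close> makes the value independent
    of the choice.\<close>
  define k where "k = (\<lambda>y. g (SOME p. p \<in> carrier P \<and> h p = y))"
  have k: "k (h p) = g p" if "p \<in> carrier P" for p
  proof -
    have "(SOME q. q \<in> carrier P \<and> h q = h p) \<in> carrier P \<and> h (SOME q. q \<in> carrier P \<and> h q = h p) = h p"
      using that by (intro someI[of "\<lambda>q. q \<in> carrier P \<and> h q = h p" p]) simp
    then show ?thesis
      unfolding k_def using eq that by blast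
  qed
  have "k \<in> ring_hom (S\<lparr>carrier := h ` carrier P\<rparr>) L"
  proof (rule ring_hom_memI)
    show "k \<one>\<^bsub>S\<lparr>carrier := h ` carrier P\<rparr>\<^esub> = \<one>\<^bsub>L\<^esub>"
      using k[of "\<one>\<^bsub>P\<^esub>"] by simp
  next
    fix y z
    assume yz: "y \<in> carrier (S\<lparr>carrier := h ` carrier P\<rparr>)" "z \<in> carrier (S\<lparr>carrier := h ` carrier P\<rparr>)"
    then obtain p q where "p \<in> carrier P" "q \<in> carrier P" "y = h p" "z = h q"
      by auto
    then show "k (y \<otimes>\<^bsub>S\<lparr>carrier := h ` carrier P\<rparr>\<^esub> z) = k y \<otimes>\<^bsub>L\<^esub> k z"
      and "k (y \<oplus>\<^bsub>S\<lparr>carrier := h ` carrier P\<rparr>\<^esub> z) = k y \<oplus>\<^bsub>L\<^esub> k z"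
      using k[of "p \<otimes>\<^bsub>P\<^esub> q"] k[of "p \<oplus>\<^bsub>P\<^esub> q"] by (simp_all add: k)
  qed (use k in auto)
  then show ?thesis
    using that k by blast
qed

text \<open>Bridge between two encodings: algebraic closedness speaks of polynomials as lists, the
  rest of the proof of coefficient functions.\<close>

lemma (in domain) exists_root_of_coefficients:
  assumes "algebraically_closed R" and "n \<noteq> (0::nat)" and "c \<in> {..n} \<rightarrow> carrier R" and "c n \<noteq> \<zero>"
  obtains t where "t \<in> carrier R" "(\<Oplus>i\<in>{..n}. c i \<otimes> t [^] i) = \<zero>"
proof -
  interpret algebraically_closed R by fact
  \<comment> \<open>Lists carry the leading coefficient first, hence the reversal.\<close>
  let ?p = "\<lambda>m. map c (rev [0..<Suc m])"
  have eval: "eval (?p m) t = (\<Oplus>i\<in>{..m}. c i \<otimes> t [^] i)" if "m \<le> n" "t \<in> carrier R" for m t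
    using that(1)
  proof (induction m)
    case 0
    then show ?case using assms(3) that(2) by (simp add: Pi_def)
  next
    case (Suc m)
    have "eval (?p (Suc m)) t = c (Suc m) \<otimes> t [^] (Suc m) \<oplus> eval (?p m) t"
      by simp
    moreover have "(\<lambda>i. c i \<otimes> t [^] i) \<in> {..Suc m} \<rightarrow> carrier R"
      using Suc.prems assms(3) that(2) by (auto simp: Pi_iff)
    ultimately show ?case
      using Suc by (simp add: finsum_Suc del: upt_Suc)
  qed
  have P: "?p n \<in> carrier (poly_ring R)"
    using assms(3,4) by (auto simp: sym[OF univ_poly_carrier] polynomial_def)
  \<comment> \<open>A splitting polynomial has as many roots, with multiplicity, as its degree, here
    \<open>n > 0\<close>.\<close>
  have "size (roots (?p n)) = n"
    using roots_over_carrier[OF P] by (simp add: splitted_def)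
  with \<open>n \<noteq> 0\<close> obtain t where "t \<in># roots (?p n)"
    by (metis multiset_nonemptyE size_empty)
  then have "t \<in> carrier R" "eval (?p n) t = \<zero>"
    using roots_mem_iff_is_root[OF P] by (auto simp: is_root_def)
  then show ?thesis
    using that eval by simp
qed

section \<open>Linear factors, binomial coefficients and additivity of the p-th power\<close>

context UP_cring
begin

text \<open>Multiplying by \<open>X\<close> shifts coefficients by one and multiplying by
  \<open>b\<close> scales them. This spares the convolution sum wherever a linear factor
  occurs.\<close>

lemma coeff_linear_mult:
  assumes "b \<in> carrier R" "f \<in> carrier P"
  shows "up_ring.coeff P ((up_ring.monom P \<one> (Suc 0) \<oplus>\<^bsub>P\<^esub> up_ring.monom P b 0) \<otimes>\<^bsub>P\<^esub> f) (Suc n) = up_ring.coeff P f n \<oplus> b \<otimes> up_ring.coeff P f (Suc n)"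
    and "up_ring.coeff P ((up_ring.monom P \<one> (Suc 0) \<oplus>\<^bsub>P\<^esub> up_ring.monom P b 0) \<otimes>\<^bsub>P\<^esub> f) 0 = b \<otimes> up_ring.coeff P f 0"
proof -
  have *: "(up_ring.monom P \<one> (Suc 0) \<oplus>\<^bsub>P\<^esub> up_ring.monom P b 0) \<otimes>\<^bsub>P\<^esub> f = up_ring.monom P \<one> (Suc 0) \<otimes>\<^bsub>P\<^esub> f \<oplus>\<^bsub>P\<^esub> b \<odot>\<^bsub>P\<^esub> f"
    using assms by (simp add: P.l_distr monom_mult_is_smult)
  have "up_ring.coeff P (up_ring.monom P \<one> (Suc 0) \<otimes>\<^bsub>P\<^esub> f) (Suc n) = up_ring.coeff P f n"
    using coeff_monom_mult[of \<one> f "Suc 0" n] assms by (simp del: coeff_mult)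
  moreover have "up_ring.coeff P (up_ring.monom P \<one> (Suc 0) \<otimes>\<^bsub>P\<^esub> f) 0 = \<zero>"
    using assms by simp
  ultimately show "up_ring.coeff P ((up_ring.monom P \<one> (Suc 0) \<oplus>\<^bsub>P\<^esub> up_ring.monom P b 0) \<otimes>\<^bsub>P\<^esub> f) (Suc n) = up_ring.coeff P f n \<oplus> b \<otimes> up_ring.coeff P f (Suc n)"
    and "up_ring.coeff P ((up_ring.monom P \<one> (Suc 0) \<oplus>\<^bsub>P\<^esub> up_ring.monom P b 0) \<otimes>\<^bsub>P\<^esub> f) 0 = b \<otimes> up_ring.coeff P f 0"
    unfolding * using assms by (simp_all del: coeff_mult)
qed

text \<open>The binomial theorem for \<open>(X + b)^n\<close>, by Pascal's rule: one more factor
  \<open>X + b\<close> adds two neighbouring coefficients.\<close>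

lemma coeff_linear_pow:
  assumes "b \<in> carrier R"
  shows "up_ring.coeff P ((up_ring.monom P \<one> (Suc 0) \<oplus>\<^bsub>P\<^esub> up_ring.monom P b 0) [^]\<^bsub>P\<^esub> n) i = [(n choose i)] \<cdot> (b [^] (n - i))"
proof (induction n arbitrary: i)
  case 0
  then show ?case by (cases i) auto
next
  case (Suc n)
  let ?l = "up_ring.monom P \<one> (Suc 0) \<oplus>\<^bsub>P\<^esub> up_ring.monom P b 0"
  have l: "?l \<in> carrier P" using assms by simp
  have pw: "?l [^]\<^bsub>P\<^esub> Suc n = ?l \<otimes>\<^bsub>P\<^esub> (?l [^]\<^bsub>P\<^esub> n)"
    using l by (simp add: P.m_comm)
  show ?case
  proof (cases i)
    case 0
    then show ?thesis
      unfolding pw using assms l by (simp add: coeff_linear_mult Suc del: coeff_mult) (simp add: R.m_comm)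
  next
    case (Suc j)
    have "up_ring.coeff P (?l [^]\<^bsub>P\<^esub> Suc n) i = [(n choose j)] \<cdot> (b [^] (n - j)) \<oplus> b \<otimes> ([(n choose Suc j)] \<cdot> (b [^] (n - Suc j)))"
      unfolding pw Suc using assms l by (simp add: coeff_linear_mult Suc.IH del: coeff_mult)
    also have "b \<otimes> ([(n choose Suc j)] \<cdot> (b [^] (n - Suc j))) = [(n choose Suc j)] \<cdot> (b [^] (n - j))"
    \<comment> \<open>For \<open>j >= n\<close> the truncated exponents no longer differ by one, but
      then \<open>n choose Suc j\<close> is 0.\<close>
    proof (cases "j < n")
      case True
      then have "n - j = Suc (n - Suc j)" by simp
      then show ?thesis using assms by (simp add: R.add_pow_rdistr R.m_comm)
    next
      case False
      then show ?thesis using assms by (simp add: binomial_eq_0)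
    qed
    finally show ?thesis
      using assms Suc R.add.nat_pow_mult[of "b [^] (n - j)" "n choose j" "n choose Suc j"] by simp
  qed
qed

end

text \<open>\<open>p\<close> divides the inner binomial coefficients, so
  \<open>(X + b)^p = X^p + b^p\<close> holds for polynomials; evaluation at \<open>a\<close> gives
  the claim.\<close>

lemma (in cring) freshmans_dream:
  assumes p: "prime (p::nat)" "[p] \<cdot> \<one> = \<zero>" and ab: "a \<in> carrier R" "b \<in> carrier R"
  shows "(a \<oplus> b) [^] p = a [^] p \<oplus> b [^] p"
proof -
  interpret U: UP_cring R "UP R" by unfold_locales
  interpret E: UP_pre_univ_prop R R id "UP R" by unfold_locales simp
  let ?P = "UP R"
  let ?l = "up_ring.monom ?P \<one> (Suc 0) \<oplus>\<^bsub>?P\<^esub> up_ring.monom ?P b 0"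
  have zero: "[k] \<cdot> y = \<zero>" if "p dvd k" "y \<in> carrier R" for k y
  proof -
    from that obtain m where "k = p * m" by auto
    moreover have "[p] \<cdot> y = \<zero>"
      using add_pow_ldistr[of \<one> y p] p(2) that(2) by simp
    ultimately show ?thesis
      using that(2) by (simp add: add.nat_pow_pow[symmetric])
  qed
  have "?l [^]\<^bsub>?P\<^esub> p = up_ring.monom ?P \<one> p \<oplus>\<^bsub>?P\<^esub> up_ring.monom ?P (b [^] p) 0"
  proof (rule U.up_eqI)
    fix i
    consider "i = 0" | "i = p" | "0 < i" "i < p" | "i > p" by linarith
    then show "up_ring.coeff ?P (?l [^]\<^bsub>?P\<^esub> p) i = up_ring.coeff ?P (up_ring.monom ?P \<one> p \<oplus>\<^bsub>?P\<^esub> up_ring.monom ?P (b [^] p) 0) i"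
    proof cases
      case 3
      then have "p dvd (p choose i)"
        using p(1) 3 by (intro dvd_choose_prime) auto
      with 3 show ?thesis
        using ab by (simp add: U.coeff_linear_pow zero)
    qed (use ab p(1) in \<open>auto simp: U.coeff_linear_pow binomial_eq_0\<close>)
  qed (use ab in auto)
  then have *: "UnivPoly.eval R R id a (?l [^]\<^bsub>?P\<^esub> p) = UnivPoly.eval R R id a (up_ring.monom ?P \<one> p \<oplus>\<^bsub>?P\<^esub> up_ring.monom ?P (b [^] p) 0)"
    by simp
  interpret H: ring_hom_cring "UP R" R "UnivPoly.eval R R id a"
    by unfold_locales (rule E.eval_ring_hom[OF ab(1)])
  show ?thesis
    using * ab E.eval_monom[of \<one> a "Suc 0"] by (simp add: E.eval_monom E.eval_const)
qed

lemma (in domain) nat_pow_nonzero: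
  assumes "a \<in> carrier R" "a \<noteq> \<zero>"
  shows "a [^] (n::nat) \<noteq> \<zero>"
  using assms by (induction n) (auto simp: integral_iff)

subsection \<open>Adjoining one element to a subring\<close>

text \<open>The base is a subring rather than a subfield because generators are adjoined repeatedly
  and the rings obtained on the way need not be fields.\<close>

locale subring_adjoin = K: "domain" K for K (structure) +
  fixes R x
  assumes subring: "subring R K" and x: "x \<in> carrier K"
begin

abbreviation KR where "KR \<equiv> K\<lparr>carrier := R\<rparr>"

text \<open>This is \<open>R[x]\<close>.\<close>

definition adjoin where "adjoin = UnivPoly.eval KR K id x ` carrier (UP KR)"

sublocale U: UP_domain KR "UP KR"
  using K.subring_is_domain[OF subring] by (simp add: UP_domain_def)

sublocale E: UP_pre_univ_prop KR K id "UP KR"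
proof (rule UP_pre_univ_propI)
  show "id \<in> ring_hom KR K"
    using subringE(1)[OF subring] by (auto intro!: ring_hom_memI)
qed unfold_locales

sublocale ev: ring_hom_cring "UP KR" K "UnivPoly.eval KR K id x"
  by unfold_locales (rule E.eval_ring_hom[OF x])

lemma subring_subset: "R \<subseteq> adjoin"
proof
  fix a assume "a \<in> R"
  then have "UnivPoly.eval KR K id x (up_ring.monom (UP KR) a 0) = a" "up_ring.monom (UP KR) a 0 \<in> carrier (UP KR)"
    using E.eval_const[OF x] by auto
  then show "a \<in> adjoin"
    unfolding adjoin_def by (metis imageI)
qed

lemma generator_mem: "x \<in> adjoin"
proof -
  have "UnivPoly.eval KR K id x (up_ring.monom (UP KR) \<one> 1) = x" "up_ring.monom (UP KR) \<one> 1 \<in> carrier (UP KR)"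
    using E.eval_monom1[OF x] U.monom_closed[of \<one> 1] subringE(3)[OF subring] by auto
  then show ?thesis
    unfolding adjoin_def by (metis imageI)
qed

lemma subring_adjoin: "subring adjoin K"
proof -
  show ?thesis
    unfolding adjoin_def by (rule ev.ring.img_is_subring[OF U.P.carrier_is_subring])
qed

text \<open>\<open>R[x]\<close> is the polynomial ring modulo the relations of \<open>x\<close>, so
  \<open>x\<close> may be sent to any \<open>t\<close> that satisfies the \<open>h\<close>-images of
  all these relations.\<close>

lemma hom_adjoin:
  assumes L: "cring L" and h: "h \<in> ring_hom KR L" and t: "t \<in> carrier L"
    and ker: "\<And>q. q \<in> carrier (UP KR) \<Longrightarrow> UnivPoly.eval KR K id x q = \<zero> \<Longrightarrow> UnivPoly.eval KR L h t q = \<zero>\<^bsub>L\<^esub>"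
  obtains g where "g \<in> ring_hom (K\<lparr>carrier := adjoin\<rparr>) L" "\<And>a. a \<in> R \<Longrightarrow> g a = h a" "g x = t"
    "\<And>q. q \<in> carrier (UP KR) \<Longrightarrow> g (UnivPoly.eval KR K id x q) = UnivPoly.eval KR L h t q"
proof -
  interpret h: UP_pre_univ_prop KR L h "UP KR"
    by (rule UP_pre_univ_propI) (use L h in \<open>auto intro: U.R.is_cring\<close>)
  obtain g where g: "g \<in> ring_hom (K\<lparr>carrier := adjoin\<rparr>) L"
    "\<And>q. q \<in> carrier (UP KR) \<Longrightarrow> g (UnivPoly.eval KR K id x q) = UnivPoly.eval KR L h t q"
    unfolding adjoin_def
    by (rule ring_hom_factor[OF U.UP_ring K.ring_axioms _ ev.homh h.eval_ring_hom[OF t] ker])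
      (use L in \<open>auto intro: cring.axioms\<close>)
  have "g a = h a" if "a \<in> R" for a
    using g(2)[of "up_ring.monom (UP KR) a 0"] that by (simp add: E.eval_const[OF x] h.eval_const[OF t])
  moreover have "g x = t"
    using g(2)[of "up_ring.monom (UP KR) \<one> 1"] E.eval_monom1[OF x] h.eval_monom1[OF t]
      U.monom_closed[of \<one> 1] subringE(3)[OF subring] by simp
  ultimately show ?thesis
    using that g by blast
qed

text \<open>Stands in for the minimal polynomial; it is not normalised to be monic, since the
  leading coefficient may fail to be a unit of \<open>R\<close>.\<close>

definition minimal_relation where
  "minimal_relation p \<longleftrightarrow> p \<in> carrier (UP KR) \<and> p \<noteq> \<zero>\<^bsub>UP KR\<^esub> \<and> UnivPoly.eval KR K id x p = \<zero> \<and>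
     (\<forall>q\<in>carrier (UP KR). UnivPoly.eval KR K id x q = \<zero> \<longrightarrow> q \<noteq> \<zero>\<^bsub>UP KR\<^esub> \<longrightarrow> deg KR p \<le> deg KR q)"

lemma minimal_relation_exists:
  assumes "p \<in> carrier (UP KR)" "p \<noteq> \<zero>\<^bsub>UP KR\<^esub>" "UnivPoly.eval KR K id x p = \<zero>"
  obtains q where "minimal_relation q"
  using ex_has_least_nat[of "\<lambda>p. p \<in> carrier (UP KR) \<and> p \<noteq> \<zero>\<^bsub>UP KR\<^esub> \<and> UnivPoly.eval KR K id x p = \<zero>" p "deg KR"]
    assms that unfolding minimal_relation_def by auto

lemma eval_degree_zero:
  assumes "p \<in> carrier (UP KR)" "deg KR p = 0"
  shows "UnivPoly.eval KR K id x p = up_ring.coeff (UP KR) p 0"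
  using U.deg_zero_impl_monom[OF assms] E.eval_const[OF x U.coeff_closed[OF assms(1)], of 0] by simp

lemma minimal_relation_deg:
  assumes "minimal_relation p"
  shows "deg KR p \<noteq> 0"
proof
  assume "deg KR p = 0"
  then have "up_ring.coeff (UP KR) p 0 = \<zero>"
    using assms eval_degree_zero[of p] unfolding minimal_relation_def by simp
  then show False
    using U.lcoeff_nonzero_nonzero[of p] \<open>deg KR p = 0\<close> assms unfolding minimal_relation_def by simp
qed

lemma eval_smult:
  assumes L: "cring L" and h: "h \<in> ring_hom KR L" and t: "t \<in> carrier L"
    and "a \<in> R" "p \<in> carrier (UP KR)"
  shows "UnivPoly.eval KR L h t (a \<odot>\<^bsub>UP KR\<^esub> p) = h a \<otimes>\<^bsub>L\<^esub> UnivPoly.eval KR L h t p"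
proof -
  interpret h: UP_pre_univ_prop KR L h "UP KR"
    by (rule UP_pre_univ_propI) (use L h in \<open>auto intro: U.R.is_cring\<close>)
  have "a \<odot>\<^bsub>UP KR\<^esub> p = up_ring.monom (UP KR) a 0 \<otimes>\<^bsub>UP KR\<^esub> p"
    using assms U.monom_mult_is_smult by simp
  then show ?thesis
    using ring_hom_mult[OF h.eval_ring_hom[OF t]] assms h.eval_const[OF t] by simp
qed

text \<open>The leading coefficient of the minimal relation need not be invertible; pseudo-division only
  requires that \<open>h\<close> does not annihilate it.\<close>

lemma minimal_relation_kernel:
  assumes p: "minimal_relation p"
    and L: "domain L" and h: "h \<in> ring_hom KR L" and t: "t \<in> carrier L"
    and lc: "h (up_ring.coeff (UP KR) p (deg KR p)) \<noteq> \<zero>\<^bsub>L\<^esub>" and root: "UnivPoly.eval KR L h t p = \<zero>\<^bsub>L\<^esub>"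
    and q: "q \<in> carrier (UP KR)" "UnivPoly.eval KR K id x q = \<zero>"
  shows "UnivPoly.eval KR L h t q = \<zero>\<^bsub>L\<^esub>"
proof -
  interpret L: "domain" L by fact
  interpret h: UP_pre_univ_prop KR L h "UP KR"
    by (rule UP_pre_univ_propI) (use h in \<open>auto intro: U.R.is_cring L.is_cring\<close>)
  interpret hev: ring_hom_cring "UP KR" L "UnivPoly.eval KR L h t"
    by unfold_locales (rule h.eval_ring_hom[OF t])
  let ?a = "up_ring.coeff (UP KR) p (deg KR p)"
  have pc: "p \<in> carrier (UP KR)" "p \<noteq> \<zero>\<^bsub>UP KR\<^esub>" "UnivPoly.eval KR K id x p = \<zero>"
    and a: "?a \<in> R"
    using p U.coeff_closed[of p "deg KR p"] unfolding minimal_relation_def by auto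
  obtain s r and k :: nat where s: "s \<in> carrier (UP KR)" and r: "r \<in> carrier (UP KR)"
    and eq: "?a [^]\<^bsub>KR\<^esub> k \<odot>\<^bsub>UP KR\<^esub> q = p \<otimes>\<^bsub>UP KR\<^esub> s \<oplus>\<^bsub>UP KR\<^esub> r"
    and dr: "r = \<zero>\<^bsub>UP KR\<^esub> \<or> deg KR r < deg KR p"
    using U.long_div_theorem[OF pc(1) q(1) pc(2)] by blast
  have ak: "?a [^]\<^bsub>KR\<^esub> k \<in> R"
    using U.R.nat_pow_closed[of ?a k] a by simp
  have "UnivPoly.eval KR K id x (?a [^]\<^bsub>KR\<^esub> k \<odot>\<^bsub>UP KR\<^esub> q) = \<zero>"
    using eval_smult[of K id, OF _ _ x ak q(1)] q(2) ak subringE(1)[OF subring] E.homh by (auto simp: K.is_cring)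
  then have "UnivPoly.eval KR K id x r = \<zero>"
    unfolding eq using pc s r by simp
  \<comment> \<open>The remainder is a relation of \<open>x\<close> of degree below that of
    \<open>p\<close>, so minimality forces it to be zero.\<close>
  then have "r = \<zero>\<^bsub>UP KR\<^esub>"
    using dr p r unfolding minimal_relation_def by fastforce
  then have "h (?a [^]\<^bsub>KR\<^esub> k) \<otimes>\<^bsub>L\<^esub> UnivPoly.eval KR L h t q = \<zero>\<^bsub>L\<^esub>"
    using arg_cong[OF eq, of "UnivPoly.eval KR L h t"] eval_smult[OF L.is_cring h t ak q(1)] pc s root by simp
  moreover have "h (?a [^]\<^bsub>KR\<^esub> k) \<noteq> \<zero>\<^bsub>L\<^esub>"
  proof -
    show ?thesis
      using lc a h.hom_pow[of ?a k] L.nat_pow_nonzero[of "h ?a" k] by simp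
  qed
  ultimately show ?thesis
    using L.integral_iff[of "h (?a [^]\<^bsub>KR\<^esub> k)" "UnivPoly.eval KR L h t q"] q ak by simp
qed

text \<open>Among the polynomials whose value at \<open>x\<close> is a nonzero multiple of
  \<open>b\<close>, one of least degree turns out to be constant. The lemma moves a nonvanishing
  condition at \<open>b\<close> down to \<open>R\<close>.\<close>

lemma algebraic_multiple_in_subring:
  assumes p: "minimal_relation p" and b: "b \<in> adjoin" "b \<noteq> \<zero>"
  obtains w where "w \<in> adjoin" "b \<otimes> w \<in> R" "b \<otimes> w \<noteq> \<zero>"
proof -
  let ?ev = "UnivPoly.eval KR K id x"
  let ?P = "UP KR"
  have bK: "b \<in> carrier K"
    using b subringE(1)[OF subring_adjoin] by auto
  have evadj: "?ev q \<in> adjoin" if "q \<in> carrier ?P" for q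
    using that by (auto simp: adjoin_def)
  \<comment> \<open>\<open>G g\<close> says that \<open>g\<close> takes a nonzero value at
    \<open>x\<close> which is a multiple of \<open>b\<close> in \<open>R[x]\<close>; a
    \<open>g\<close> of degree 0 with this property proves the claim.\<close>
  define G where "G g \<longleftrightarrow> g \<in> carrier ?P \<and> ?ev g \<noteq> \<zero> \<and> (\<exists>w\<in>adjoin. ?ev g = b \<otimes> w)" for g
  obtain g0 where "g0 \<in> carrier ?P" "?ev g0 = b"
    using b by (auto simp: adjoin_def)
  then have "G g0"
    unfolding G_def using b bK subringE(3)[OF subring_adjoin] by (metis K.r_one)
  then obtain g where g: "G g" and gmin: "\<And>g'. G g' \<Longrightarrow> deg KR g \<le> deg KR g'"
    using ex_has_least_nat[of G g0 "deg KR"] by blast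
  obtain w where w: "w \<in> adjoin" "?ev g = b \<otimes> w" and gc: "g \<in> carrier ?P" "?ev g \<noteq> \<zero>"
    using g unfolding G_def by auto
  have wK: "w \<in> carrier K"
    using w subringE(1)[OF subring_adjoin] by auto
  have g0: "g \<noteq> \<zero>\<^bsub>?P\<^esub>"
    using gc by auto
  have pc: "p \<in> carrier ?P" "p \<noteq> \<zero>\<^bsub>?P\<^esub>" "?ev p = \<zero>"
    and pmin: "\<And>q. q \<in> carrier ?P \<Longrightarrow> ?ev q = \<zero> \<Longrightarrow> q \<noteq> \<zero>\<^bsub>?P\<^esub> \<Longrightarrow> deg KR p \<le> deg KR q"
    using p unfolding minimal_relation_def by auto
  have sm: "?ev (a \<odot>\<^bsub>?P\<^esub> q) = a \<otimes> ?ev q" if "a \<in> R" "q \<in> carrier ?P" for a q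
    using eval_smult[of K id, OF _ _ x] that E.homh by (simp add: K.is_cring)
  have lc: "up_ring.coeff ?P f (deg KR f) \<in> R" "up_ring.coeff ?P f (deg KR f) \<noteq> \<zero>"
    "up_ring.coeff ?P f (deg KR f) [^]\<^bsub>KR\<^esub> k \<in> R" "up_ring.coeff ?P f (deg KR f) [^]\<^bsub>KR\<^esub> k \<noteq> \<zero>"
    if "f \<in> carrier ?P" "f \<noteq> \<zero>\<^bsub>?P\<^esub>" for f and k :: nat
    using U.coeff_closed[OF that(1), of "deg KR f"] U.lcoeff_nonzero[OF that(2,1)]
      U.R.nat_pow_closed[of "up_ring.coeff ?P f (deg KR f)" k] U.R.nat_pow_nonzero[of "up_ring.coeff ?P f (deg KR f)" k] by auto
  have RK: "a \<in> carrier K" "a \<in> adjoin" if "a \<in> R" for a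
    using that subringE(1)[OF subring] subring_subset by auto
  \<comment> \<open>Pseudo-division of one of \<open>p\<close>, \<open>g\<close> by the other gives a remainder which is again a multiple
    of \<open>b\<close> (so minimality of \<open>g\<close> applies) or a relation of smaller degree.\<close>
  have gp: "deg KR g \<le> deg KR p"
  proof (rule ccontr)
    assume *: "\<not> ?thesis"
    let ?a = "up_ring.coeff ?P p (deg KR p)"
    obtain s r and k :: nat where s: "s \<in> carrier ?P" and r: "r \<in> carrier ?P"
      and eq: "?a [^]\<^bsub>KR\<^esub> k \<odot>\<^bsub>?P\<^esub> g = p \<otimes>\<^bsub>?P\<^esub> s \<oplus>\<^bsub>?P\<^esub> r"
      and dr: "r = \<zero>\<^bsub>?P\<^esub> \<or> deg KR r < deg KR p"
      using U.long_div_theorem[OF pc(1) gc(1) pc(2)] by blast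
    note ak = lc(3,4)[OF pc(1,2), of k]
    have "?ev r = ?a [^]\<^bsub>KR\<^esub> k \<otimes> ?ev g"
      using arg_cong[OF eq, of ?ev] sm[OF ak(1) gc(1)] pc s r by simp
    then have "?ev r = b \<otimes> (?a [^]\<^bsub>KR\<^esub> k \<otimes> w)" "?ev r \<noteq> \<zero>"
      using w bK wK RK[OF ak(1)] ak(2) gc(1,2) by (auto simp: K.m_lcomm K.integral_iff)
    then have "G r"
      unfolding G_def using r subringE(6)[OF subring_adjoin RK(2)[OF ak(1)] w(1)] by auto
    then show False
      using gmin[of r] dr * \<open>?ev r \<noteq> \<zero>\<close> by auto
  qed
  have "deg KR g = 0"
  proof (rule ccontr)
    assume *: "deg KR g \<noteq> 0"
    let ?a = "up_ring.coeff ?P g (deg KR g)"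
    obtain s r and k :: nat where s: "s \<in> carrier ?P" and r: "r \<in> carrier ?P"
      and eq: "?a [^]\<^bsub>KR\<^esub> k \<odot>\<^bsub>?P\<^esub> p = g \<otimes>\<^bsub>?P\<^esub> s \<oplus>\<^bsub>?P\<^esub> r"
      and dr: "r = \<zero>\<^bsub>?P\<^esub> \<or> deg KR r < deg KR g"
      using U.long_div_theorem[OF gc(1) pc(1) g0] by blast
    note ak = lc(3,4)[OF gc(1) g0, of k]
    have gsr: "?ev g \<otimes> ?ev s \<oplus> ?ev r = \<zero>"
      using arg_cong[OF eq, of ?ev] sm[OF ak(1) pc(1)] pc s r gc RK[OF ak(1)] by simp
    \<comment> \<open>Otherwise \<open>r\<close> would satisfy \<open>G\<close> with smaller degree
      than \<open>g\<close>.\<close>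
    have "?ev r = \<zero>"
    proof (rule ccontr)
      assume r0: "?ev r \<noteq> \<zero>"
      have "?ev r = \<ominus> (?ev g \<otimes> ?ev s)"
        using gsr r gc s by (metis K.a_comm K.m_closed K.minus_equality ev.hom_closed)
      then have "?ev r = b \<otimes> (\<ominus> (w \<otimes> ?ev s))"
        using w bK wK s by (simp add: K.m_assoc K.r_minus)
      then have "G r"
        unfolding G_def using r r0 subringE(5,6)[OF subring_adjoin] w evadj[OF s] by blast
      then show False
        using gmin[of r] dr r0 by auto
    qed
    \<comment> \<open>Now \<open>r\<close> is a relation of \<open>x\<close>, and a nonzero one
      would have degree below \<open>deg g\<close>, hence below \<open>deg p\<close>.\<close>
    then have r0: "r = \<zero>\<^bsub>?P\<^esub>"
      using dr pmin[OF r] gp by fastforce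
    \<comment> \<open>\<open>g\<close> does not vanish at \<open>x\<close>, so \<open>s\<close>
      does. But \<open>s\<close> has degree \<open>deg p - deg g\<close>, which is too small for a
      nonzero relation when \<open>g\<close> is not constant.\<close>
    have "?ev s = \<zero>"
      using gsr \<open>?ev r = \<zero>\<close> gc s by (simp add: K.integral_iff)
    have eq': "?a [^]\<^bsub>KR\<^esub> k \<odot>\<^bsub>?P\<^esub> p = g \<otimes>\<^bsub>?P\<^esub> s"
      using eq r0 gc s by simp
    have deg: "deg KR (g \<otimes>\<^bsub>?P\<^esub> s) = deg KR p"
      unfolding eq'[symmetric] using ak pc by simp
    moreover have "s \<noteq> \<zero>\<^bsub>?P\<^esub>"
      using deg gc minimal_relation_deg[OF p] by auto
    ultimately have "deg KR g + deg KR s = deg KR p"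
      using gc s g0 by simp
    then show False
      using pmin[OF s \<open>?ev s = \<zero>\<close> \<open>s \<noteq> _\<close>] * by simp
  qed
  then have "?ev g \<in> R"
    using eval_degree_zero[OF gc(1)] U.coeff_closed[OF gc(1), of 0] by simp
  then show ?thesis
    using that w gc by auto
qed

end

subsection \<open>Extending homomorphisms into an algebraically closed field\<close>

text \<open>The leading coefficient survives \<open>h\<close>, so the image of \<open>p\<close> over
  \<open>L\<close> still has positive degree.\<close>

lemma algebraically_closed_root:
  assumes "algebraically_closed L" and R: "cring R" and h: "h \<in> ring_hom R L"
    and p: "p \<in> carrier (UP R)" "deg R p \<noteq> 0" and lc: "h (up_ring.coeff (UP R) p (deg R p)) \<noteq> \<zero>\<^bsub>L\<^esub>"
  obtains t where "t \<in> carrier L" "UnivPoly.eval R L h t p = \<zero>\<^bsub>L\<^esub>"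
proof -
  interpret algebraically_closed L by fact
  interpret h: UP_pre_univ_prop R L h "UP R"
    by (rule UP_pre_univ_propI) (use R h is_cring in auto)
  have "(\<lambda>i. h (up_ring.coeff (UP R) p i)) \<in> {..deg R p} \<rightarrow> carrier L"
    using p by simp
  then obtain t where "t \<in> carrier L"
    "(\<Oplus>\<^bsub>L\<^esub>i\<in>{..deg R p}. h (up_ring.coeff (UP R) p i) \<otimes>\<^bsub>L\<^esub> t [^]\<^bsub>L\<^esub> i) = \<zero>\<^bsub>L\<^esub>"
    using exists_root_of_coefficients[where c = "\<lambda>i. h (up_ring.coeff (UP R) p i)", OF assms(1) p(2)] lc by metis
  then show ?thesis
    using that h.eval_on_carrier[OF p(1), of L h] by simp
qed

lemma carrier_UP: "carrier (UP R) = up R"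
  by (simp add: UP_def)

lemma coeff_UP: "p \<in> up R \<Longrightarrow> up_ring.coeff (UP R) p = p"
  by (simp add: UP_def)

text \<open>Transports \<open>p\<close> to \<open>L\<close>, where evaluation along \<open>h\<close>
  becomes ordinary evaluation and facts on polynomials over a field apply. The degree cannot drop
  because the leading coefficient survives.\<close>

lemma map_UP:
  assumes R: "cring R" and L: "cring L" and h: "h \<in> ring_hom R L"
    and p: "p \<in> carrier (UP R)" and lc: "h (up_ring.coeff (UP R) p (deg R p)) \<noteq> \<zero>\<^bsub>L\<^esub>"
  obtains q where "q \<in> carrier (UP L)" "\<And>n. up_ring.coeff (UP L) q n = h (up_ring.coeff (UP R) p n)"
    "deg L q = deg R p" "\<And>t. UnivPoly.eval L L id t q = UnivPoly.eval R L h t p"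
proof -
  interpret h: UP_pre_univ_prop R L h "UP R"
    by (rule UP_pre_univ_propI) (use R L h in auto)
  interpret L: UP_cring L "UP L"
    using L by (simp add: UP_cring_def)
  define q where "q = (\<lambda>n. h (up_ring.coeff (UP R) p n))"
  have "q \<in> up L"
  proof (rule mem_upI)
    show "q n \<in> carrier L" for n
      using p by (simp add: q_def)
    have "bound \<zero>\<^bsub>L\<^esub> (deg R p) q"
      by (rule bound.intro) (simp add: q_def p h.deg_aboveD)
    then show "\<exists>n. bound \<zero>\<^bsub>L\<^esub> n q" ..
  qed
  then have q: "q \<in> carrier (UP L)" and "up_ring.coeff (UP L) q = q"
    by (simp_all add: carrier_UP coeff_UP)
  then have cq: "up_ring.coeff (UP L) q n = h (up_ring.coeff (UP R) p n)" for n
    by (simp add: q_def)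
  have d: "deg L q = deg R p"
    by (intro le_antisym L.deg_aboveI L.deg_belowI) (use q lc h.deg_aboveD[OF _ p] in \<open>auto simp: cq\<close>)
  have "UnivPoly.eval L L id t q = UnivPoly.eval R L h t p" for t
    using h.eval_on_carrier[OF p, of L h] L.eval_on_carrier[OF q, of L id] d cq by simp
  then show ?thesis
    by (intro that[of q] q cq d)
qed

text \<open>Supplies images for a transcendental generator: \<open>t\<close> avoids a prescribed
  value as well as the zeros of the image of \<open>p\<close>.\<close>

lemma algebraically_closed_avoid:
  assumes ac: "algebraically_closed L" and R: "cring R" and h: "h \<in> ring_hom R L"
    and p: "p \<in> carrier (UP R)" and lc: "h (up_ring.coeff (UP R) p (deg R p)) \<noteq> \<zero>\<^bsub>L\<^esub>"
  obtains t where "t \<in> carrier L" "t \<noteq> s" "UnivPoly.eval R L h t p \<noteq> \<zero>\<^bsub>L\<^esub>"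
proof -
  interpret L: algebraically_closed L by fact
  interpret U: UP_domain L "UP L" by unfold_locales
  interpret E: UP_pre_univ_prop L L id "UP L" by unfold_locales simp
  \<comment> \<open>If \<open>s\<close> lies outside \<open>L\<close>, every \<open>t\<close> in
    \<open>L\<close> differs from it, and zero serves as a placeholder.\<close>
  define s' where "s' = (if s \<in> carrier L then s else \<zero>\<^bsub>L\<^esub>)"
  have s': "s' \<in> carrier L" and s'_eq: "s \<in> carrier L \<Longrightarrow> s' = s" 
    by (auto simp: s'_def)
  obtain q where q: "q \<in> carrier (UP L)" "\<And>n. up_ring.coeff (UP L) q n = h (up_ring.coeff (UP R) p n)"
    "deg L q = deg R p" "\<And>t. UnivPoly.eval L L id t q = UnivPoly.eval R L h t p"
    by (rule map_UP[OF R L.is_cring h p lc], rule that)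
  \<comment> \<open>A root of \<open>(X - s') q - 1\<close> is neither \<open>s'\<close> nor a root of \<open>q\<close>.\<close>
  let ?l = "up_ring.monom (UP L) \<one>\<^bsub>L\<^esub> (Suc 0) \<oplus>\<^bsub>UP L\<^esub> up_ring.monom (UP L) (\<ominus>\<^bsub>L\<^esub> s') 0"
  let ?f = "?l \<otimes>\<^bsub>UP L\<^esub> q \<ominus>\<^bsub>UP L\<^esub> \<one>\<^bsub>UP L\<^esub>"
  have l: "?l \<in> carrier (UP L)" and f: "?f \<in> carrier (UP L)"
    using s' q by auto
  have "up_ring.coeff (UP L) ?f (Suc (deg L q)) = up_ring.coeff (UP L) q (deg L q)"
    using s' q(1) l U.coeff_linear_mult(1)[of "\<ominus>\<^bsub>L\<^esub> s'" q "deg L q"]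
    by (simp add: U.coeff_minus U.deg_aboveD a_minus_def del: U.coeff_mult U.monom_a_inv)
  \<comment> \<open>Subtracting 1 affects only the constant coefficient, so the degree is positive
    even when \<open>q\<close> is constant.\<close>
  then have "Suc (deg L q) \<le> deg L ?f"
    using lc q f by (intro U.deg_belowI) auto
  then have d: "deg L ?f \<noteq> 0" by simp
  obtain t where t: "t \<in> carrier L" "UnivPoly.eval L L id t ?f = \<zero>\<^bsub>L\<^esub>"
    by (rule algebraically_closed_root[OF ac L.is_cring id_ring_hom f d])
      (use U.lcoeff_nonzero_deg[OF d f] that in simp_all)
  interpret H: ring_hom_cring "UP L" L "UnivPoly.eval L L id t"
    by unfold_locales (rule E.eval_ring_hom[OF t(1)])
  have "(t \<oplus>\<^bsub>L\<^esub> \<ominus>\<^bsub>L\<^esub> s') \<otimes>\<^bsub>L\<^esub> UnivPoly.eval L L id t q = \<one>\<^bsub>L\<^esub>"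
    using t s' q(1) l E.eval_monom[of "\<one>\<^bsub>L\<^esub>" t "Suc 0"] by (simp add: E.eval_const)
  moreover have "t \<noteq> s'"
    using calculation t(1) L.r_neg[of t] H.hom_closed[OF q(1)] by auto
  ultimately have "t \<noteq> s'" "UnivPoly.eval L L id t q \<noteq> \<zero>\<^bsub>L\<^esub>"
    using t(1) s' by auto
  then show ?thesis
    using that t(1) q(4) s'_eq by metis
qed

text \<open>For rings \<open>R \<subseteq> S\<close>: the classical extension theorem for homomorphisms of finitely
  generated algebras, as a relation so that it can be iterated over the generators.\<close>

definition hom_extends where
  "hom_extends K L R S \<longleftrightarrow> (\<forall>b\<in>S - {\<zero>\<^bsub>K\<^esub>}. \<exists>c\<in>R - {\<zero>\<^bsub>K\<^esub>}. \<forall>h\<in>ring_hom (K\<lparr>carrier := R\<rparr>) L. h c \<noteq> \<zero>\<^bsub>L\<^esub> \<longrightarrow>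
     (\<exists>g\<in>ring_hom (K\<lparr>carrier := S\<rparr>) L. (\<forall>a\<in>R. g a = h a) \<and> g b \<noteq> \<zero>\<^bsub>L\<^esub>))"

lemma hom_extends_refl: "hom_extends K L R R"
  unfolding hom_extends_def
proof
  fix b assume b: "b \<in> R - {\<zero>\<^bsub>K\<^esub>}"
  show "\<exists>c\<in>R - {\<zero>\<^bsub>K\<^esub>}. \<forall>h\<in>ring_hom (K\<lparr>carrier := R\<rparr>) L. h c \<noteq> \<zero>\<^bsub>L\<^esub> \<longrightarrow>
     (\<exists>g\<in>ring_hom (K\<lparr>carrier := R\<rparr>) L. (\<forall>a\<in>R. g a = h a) \<and> g b \<noteq> \<zero>\<^bsub>L\<^esub>)"
  proof (rule bexI[OF _ b], intro ballI impI)
    fix h assume "h \<in> ring_hom (K\<lparr>carrier := R\<rparr>) L" "h b \<noteq> \<zero>\<^bsub>L\<^esub>"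
    then show "\<exists>g\<in>ring_hom (K\<lparr>carrier := R\<rparr>) L. (\<forall>a\<in>R. g a = h a) \<and> g b \<noteq> \<zero>\<^bsub>L\<^esub>"
      by (intro bexI[of _ h] conjI ballI refl)
  qed
qed

text \<open>The condition at \<open>b\<close> is pulled back to \<open>c\<close> in \<open>S\<close>
  and then to \<open>d\<close> in \<open>R\<close>. This chaining is why the relation asks for
  extensions that do not vanish at a given element.\<close>

lemma hom_extends_trans:
  assumes sub: "R \<subseteq> S" and RS: "hom_extends K L R S" and ST: "hom_extends K L S T"
  shows "hom_extends K L R T"
  unfolding hom_extends_def
proof
  fix b assume b: "b \<in> T - {\<zero>\<^bsub>K\<^esub>}"
  obtain c where c: "c \<in> S - {\<zero>\<^bsub>K\<^esub>}"
    and extS: "\<forall>h\<in>ring_hom (K\<lparr>carrier := S\<rparr>) L. h c \<noteq> \<zero>\<^bsub>L\<^esub> \<longrightarrow>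
      (\<exists>g\<in>ring_hom (K\<lparr>carrier := T\<rparr>) L. (\<forall>a\<in>S. g a = h a) \<and> g b \<noteq> \<zero>\<^bsub>L\<^esub>)"
    using bspec[OF ST[unfolded hom_extends_def] b] by (elim bexE)
  obtain d where d: "d \<in> R - {\<zero>\<^bsub>K\<^esub>}"
    and extR: "\<forall>h\<in>ring_hom (K\<lparr>carrier := R\<rparr>) L. h d \<noteq> \<zero>\<^bsub>L\<^esub> \<longrightarrow>
      (\<exists>g\<in>ring_hom (K\<lparr>carrier := S\<rparr>) L. (\<forall>a\<in>R. g a = h a) \<and> g c \<noteq> \<zero>\<^bsub>L\<^esub>)"
    using bspec[OF RS[unfolded hom_extends_def] c] by (elim bexE)
  show "\<exists>d\<in>R - {\<zero>\<^bsub>K\<^esub>}. \<forall>h\<in>ring_hom (K\<lparr>carrier := R\<rparr>) L. h d \<noteq> \<zero>\<^bsub>L\<^esub> \<longrightarrow>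
     (\<exists>g\<in>ring_hom (K\<lparr>carrier := T\<rparr>) L. (\<forall>a\<in>R. g a = h a) \<and> g b \<noteq> \<zero>\<^bsub>L\<^esub>)"
  proof (rule bexI[OF _ d], intro ballI impI)
    fix h assume h: "h \<in> ring_hom (K\<lparr>carrier := R\<rparr>) L" "h d \<noteq> \<zero>\<^bsub>L\<^esub>"
    obtain h' where h': "h' \<in> ring_hom (K\<lparr>carrier := S\<rparr>) L" "\<forall>a\<in>R. h' a = h a" "h' c \<noteq> \<zero>\<^bsub>L\<^esub>"
      using mp[OF bspec[OF extR h(1)] h(2)] by (elim bexE conjE)
    obtain g where g: "g \<in> ring_hom (K\<lparr>carrier := T\<rparr>) L" "\<forall>a\<in>S. g a = h' a" "g b \<noteq> \<zero>\<^bsub>L\<^esub>"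
      using mp[OF bspec[OF extS h'(1)] h'(3)] by (elim bexE conjE)
    have "\<forall>a\<in>R. g a = h a"
      using g(2) h'(2) sub by (simp add: subset_eq)
    with g(1,3) show "\<exists>g\<in>ring_hom (K\<lparr>carrier := T\<rparr>) L. (\<forall>a\<in>R. g a = h a) \<and> g b \<noteq> \<zero>\<^bsub>L\<^esub>"
      by (intro bexI[of _ g] conjI)
  qed
qed

section \<open>Extension over one generator: algebraic and transcendental case\<close>

context subring_adjoin
begin

text \<open>The root \<open>t\<close> is left free, so that a root different from \<open>x\<close>
  can be prescribed later. The last property ensures that roots in an algebraically closed
  \<open>L\<close> exist.\<close>

lemma algebraic_hom_nonzero:
  assumes p: "minimal_relation p" and L: "domain L"
    and b: "b \<in> adjoin" "b \<noteq> \<zero>"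
  obtains c where "c \<in> R" "c \<noteq> \<zero>" and
    "\<And>h t. h \<in> ring_hom KR L \<Longrightarrow> h c \<noteq> \<zero>\<^bsub>L\<^esub> \<Longrightarrow> t \<in> carrier L \<Longrightarrow> UnivPoly.eval KR L h t p = \<zero>\<^bsub>L\<^esub> \<Longrightarrow>
      \<exists>g\<in>ring_hom (K\<lparr>carrier := adjoin\<rparr>) L. (\<forall>a\<in>R. g a = h a) \<and> g x = t \<and> g b \<noteq> \<zero>\<^bsub>L\<^esub>"
    "\<And>h. h \<in> ring_hom KR L \<Longrightarrow> h c \<noteq> \<zero>\<^bsub>L\<^esub> \<Longrightarrow> h (up_ring.coeff (UP KR) p (deg KR p)) \<noteq> \<zero>\<^bsub>L\<^esub>"
proof -
  interpret L: "domain" L by fact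
  have pc: "p \<in> carrier (UP KR)" "p \<noteq> \<zero>\<^bsub>UP KR\<^esub>"
    using p unfolding minimal_relation_def by auto
  obtain w where w: "w \<in> adjoin" "b \<otimes> w \<in> R" "b \<otimes> w \<noteq> \<zero>"
    by (rule algebraic_multiple_in_subring[OF p b], rule that)
  let ?a = "up_ring.coeff (UP KR) p (deg KR p)"
  \<comment> \<open>If \<open>h\<close> does not kill the first factor, pseudo-division by
    \<open>p\<close> works; if it does not kill the second, no extension can vanish at
    \<open>b\<close>.\<close>
  let ?c = "?a \<otimes> (b \<otimes> w)"
  have a: "?a \<in> R" "?a \<noteq> \<zero>"
    using U.coeff_closed[OF pc(1), of "deg KR p"] U.lcoeff_nonzero[OF pc(2,1)] by auto
  have c: "?c \<in> R" "?c \<noteq> \<zero>"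
    using a w subringE(1,6)[OF subring] by (auto simp: K.integral_iff subset_eq)
  have fac: "h ?a \<noteq> \<zero>\<^bsub>L\<^esub>" "h (b \<otimes> w) \<noteq> \<zero>\<^bsub>L\<^esub>" if "h \<in> ring_hom KR L" "h ?c \<noteq> \<zero>\<^bsub>L\<^esub>" for h
    using ring_hom_mult[OF that(1), of ?a "b \<otimes> w"] ring_hom_closed[OF that(1), of ?a]
      ring_hom_closed[OF that(1), of "b \<otimes> w"] a w that(2) by auto
  show ?thesis
  proof (rule that[OF c])
    fix h t assume h: "h \<in> ring_hom KR L" "h ?c \<noteq> \<zero>\<^bsub>L\<^esub>"
      and t: "t \<in> carrier L" "UnivPoly.eval KR L h t p = \<zero>\<^bsub>L\<^esub>"
    obtain g where g: "g \<in> ring_hom (K\<lparr>carrier := adjoin\<rparr>) L" "\<And>a. a \<in> R \<Longrightarrow> g a = h a" "g x = t"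
      by (rule hom_adjoin[OF L.is_cring h(1) t(1) ], erule (1) minimal_relation_kernel[OF p L h(1) t(1) fac(1)[OF h] t(2)], rule that)
    have "g b \<otimes>\<^bsub>L\<^esub> g w \<noteq> \<zero>\<^bsub>L\<^esub>"
      using ring_hom_mult[OF g(1), of b w] g(2)[OF w(2)] fac(2)[OF h] b w by simp
    then have "g b \<noteq> \<zero>\<^bsub>L\<^esub>"
      using ring_hom_closed[OF g(1), of w] w by auto
    then show "\<exists>g\<in>ring_hom (K\<lparr>carrier := adjoin\<rparr>) L. (\<forall>a\<in>R. g a = h a) \<and> g x = t \<and> g b \<noteq> \<zero>\<^bsub>L\<^esub>"
      using g by blast
  qed (use fac in blast)
qed

text \<open>Without relations every \<open>t\<close> is an admissible image of \<open>x\<close>; it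
  only has to avoid \<open>s\<close> and the zeros of the image of a polynomial representing
  \<open>b\<close>.\<close>

lemma transcendental_hom_nonzero:
  assumes tr: "\<And>p. p \<in> carrier (UP KR) \<Longrightarrow> UnivPoly.eval KR K id x p = \<zero> \<Longrightarrow> p = \<zero>\<^bsub>UP KR\<^esub>"
    and ac: "algebraically_closed L" and b: "b \<in> adjoin" "b \<noteq> \<zero>"
  obtains c where "c \<in> R" "c \<noteq> \<zero>" and
    "\<And>h s. h \<in> ring_hom KR L \<Longrightarrow> h c \<noteq> \<zero>\<^bsub>L\<^esub> \<Longrightarrow>
      \<exists>g\<in>ring_hom (K\<lparr>carrier := adjoin\<rparr>) L. (\<forall>a\<in>R. g a = h a) \<and> g x \<noteq> s \<and> g b \<noteq> \<zero>\<^bsub>L\<^esub>"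
proof -
  interpret L: algebraically_closed L by fact
  obtain p where p: "p \<in> carrier (UP KR)" "UnivPoly.eval KR K id x p = b"
    using b by (auto simp: adjoin_def)
  then have p0: "p \<noteq> \<zero>\<^bsub>UP KR\<^esub>"
    using b by auto
  \<comment> \<open>If \<open>h\<close> keeps this leading coefficient, the image of
    \<open>p\<close> is nonzero and its zeros can be avoided.\<close>
  let ?c = "up_ring.coeff (UP KR) p (deg KR p)"
  have c: "?c \<in> R" "?c \<noteq> \<zero>"
    using U.coeff_closed[OF p(1), of "deg KR p"] U.lcoeff_nonzero[OF p0 p(1)] by auto
  show ?thesis
  proof (rule that[OF c])
    fix h s assume h: "h \<in> ring_hom KR L" "h ?c \<noteq> \<zero>\<^bsub>L\<^esub>"
    interpret h: UP_pre_univ_prop KR L h "UP KR"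
      by (rule UP_pre_univ_propI) (use h in \<open>auto intro: U.R.is_cring L.is_cring\<close>)
    obtain t where t: "t \<in> carrier L" "t \<noteq> s" "UnivPoly.eval KR L h t p \<noteq> \<zero>\<^bsub>L\<^esub>"
      by (rule algebraically_closed_avoid[OF ac U.R.is_cring h(1) p(1) h(2)], rule that)
    interpret H: ring_hom_cring "UP KR" L "UnivPoly.eval KR L h t"
      by unfold_locales (rule h.eval_ring_hom[OF t(1)])
    have ker: "UnivPoly.eval KR L h t q = \<zero>\<^bsub>L\<^esub>" if "q \<in> carrier (UP KR)" "UnivPoly.eval KR K id x q = \<zero>" for q
      using tr[OF that] by simp
    obtain g where g: "g \<in> ring_hom (K\<lparr>carrier := adjoin\<rparr>) L" "\<And>a. a \<in> R \<Longrightarrow> g a = h a" "g x = t"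
      "\<And>q. q \<in> carrier (UP KR) \<Longrightarrow> g (UnivPoly.eval KR K id x q) = UnivPoly.eval KR L h t q"
      by (rule hom_adjoin[OF L.is_cring h(1) t(1)], rule ker, assumption+, rule that)
    then show "\<exists>g\<in>ring_hom (K\<lparr>carrier := adjoin\<rparr>) L. (\<forall>a\<in>R. g a = h a) \<and> g x \<noteq> s \<and> g b \<noteq> \<zero>\<^bsub>L\<^esub>"
      using t g(4)[OF p(1)] p(2) by (metis)
  qed
qed

lemma hom_extends_adjoin:
  assumes ac: "algebraically_closed L"
  shows "hom_extends K L R adjoin"
  unfolding hom_extends_def
proof
  interpret L: algebraically_closed L by fact
  fix b assume "b \<in> adjoin - {\<zero>}"
  then have b: "b \<in> adjoin" "b \<noteq> \<zero>" by auto
  let ?extends = "\<lambda>h. \<exists>g\<in>ring_hom (K\<lparr>carrier := adjoin\<rparr>) L. (\<forall>a\<in>R. g a = h a) \<and> g b \<noteq> \<zero>\<^bsub>L\<^esub>"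
  have "\<exists>c. c \<in> R \<and> c \<noteq> \<zero> \<and> (\<forall>h\<in>ring_hom KR L. h c \<noteq> \<zero>\<^bsub>L\<^esub> \<longrightarrow> ?extends h)"
  proof (cases "\<exists>p. minimal_relation p")
    case True
    then obtain p where p: "minimal_relation p" by (elim exE)
    show ?thesis
    proof (rule algebraic_hom_nonzero[OF p L.domain_axioms b])
      fix c assume c: "c \<in> R" "c \<noteq> \<zero>" and
        ext: "\<And>h t. h \<in> ring_hom KR L \<Longrightarrow> h c \<noteq> \<zero>\<^bsub>L\<^esub> \<Longrightarrow> t \<in> carrier L \<Longrightarrow> UnivPoly.eval KR L h t p = \<zero>\<^bsub>L\<^esub> \<Longrightarrow>
        \<exists>g\<in>ring_hom (K\<lparr>carrier := adjoin\<rparr>) L. (\<forall>a\<in>R. g a = h a) \<and> g x = t \<and> g b \<noteq> \<zero>\<^bsub>L\<^esub>"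
        "\<And>h. h \<in> ring_hom KR L \<Longrightarrow> h c \<noteq> \<zero>\<^bsub>L\<^esub> \<Longrightarrow> h (up_ring.coeff (UP KR) p (deg KR p)) \<noteq> \<zero>\<^bsub>L\<^esub>"
      have ex: "?extends h" if h: "h \<in> ring_hom KR L" "h c \<noteq> \<zero>\<^bsub>L\<^esub>" for h
      proof -
        have "p \<in> carrier (UP KR)" using p by (simp add: minimal_relation_def)
        from algebraically_closed_root[OF ac U.R.is_cring h(1) this minimal_relation_deg[OF p] ext(2)[OF h]]
        obtain t where t: "t \<in> carrier L" "UnivPoly.eval KR L h t p = \<zero>\<^bsub>L\<^esub>" .
        show ?thesis
          using ext(1)[OF h t] by (elim bexE conjE) (intro bexI conjI)
      qed
      show ?thesis by (intro exI[of _ c] conjI ballI impI c ex)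
    qed
  next
    case False
    have "p = \<zero>\<^bsub>UP KR\<^esub>" if "p \<in> carrier (UP KR)" "UnivPoly.eval KR K id x p = \<zero>" for p
      using minimal_relation_exists[OF that(1) _ that(2)] False by blast
    then show ?thesis
    proof (rule transcendental_hom_nonzero[OF _ ac b])
      fix c assume c: "c \<in> R" "c \<noteq> \<zero>"
        and ext: "\<And>h s. h \<in> ring_hom KR L \<Longrightarrow> h c \<noteq> \<zero>\<^bsub>L\<^esub> \<Longrightarrow>
          \<exists>g\<in>ring_hom (K\<lparr>carrier := adjoin\<rparr>) L. (\<forall>a\<in>R. g a = h a) \<and> g x \<noteq> s \<and> g b \<noteq> \<zero>\<^bsub>L\<^esub>"
      have ex: "?extends h" if h: "h \<in> ring_hom KR L" "h c \<noteq> \<zero>\<^bsub>L\<^esub>" for h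
        \<comment> \<open>Here \<open>s\<close> is an arbitrary value; a specific one matters only
          when \<open>r\<close> has to be moved.\<close>
        using ext[OF h, of "\<zero>\<^bsub>L\<^esub>"] by (elim bexE conjE) (intro bexI conjI)
      show ?thesis by (intro exI[of _ c] conjI ballI impI c ex)
    qed
  qed
  then obtain c where c: "c \<in> R" "c \<noteq> \<zero>" "\<forall>h\<in>ring_hom KR L. h c \<noteq> \<zero>\<^bsub>L\<^esub> \<longrightarrow> ?extends h"
    by (elim exE conjE)
  from c(1,2) have cR: "c \<in> R - {\<zero>}"
    by simp
  show "\<exists>c\<in>R - {\<zero>}. \<forall>h\<in>ring_hom KR L. h c \<noteq> \<zero>\<^bsub>L\<^esub> \<longrightarrow> ?extends h"
    by (rule bexI[OF _ cR]) (rule c(3))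
qed

end

text \<open>The elements of \<open>A\<close> are adjoined one at a time, and the extension steps are
  composed by transitivity.\<close>

lemma (in domain) hom_extends_finite:
  assumes ac: "algebraically_closed L" and R: "subring R' R" and A: "finite A" "A \<subseteq> carrier R"
  shows "\<exists>S. subring S R \<and> R' \<subseteq> S \<and> A \<subseteq> S \<and> hom_extends R L R' S"
  using A
proof (induction A rule: finite_induct)
  case empty
  then show ?case
    by (intro exI[of _ R'] conjI R hom_extends_refl subset_refl empty_subsetI)
next
  case (insert x A)
  have A': "A \<subseteq> carrier R"
    using insert.prems by simp
  obtain S where S: "subring S R" "R' \<subseteq> S" "A \<subseteq> S" "hom_extends R L R' S"
    using insert.IH[OF A'] by (elim exE conjE)
  interpret a: subring_adjoin R S x
    by (intro subring_adjoin.intro subring_adjoin_axioms.intro domain_axioms S(1)) (use insert.prems in simp)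
  have sub: "R' \<subseteq> a.adjoin" "insert x A \<subseteq> a.adjoin"
    using subset_trans[OF S(2) a.subring_subset] subset_trans[OF S(3) a.subring_subset] a.generator_mem
    by (simp_all only: insert_subset simp_thms)
  have ext: "hom_extends R L R' a.adjoin"
    by (rule hom_extends_trans[OF S(2,4) a.hom_extends_adjoin[OF ac]])
  show ?case
    using a.subring_adjoin sub ext by (simp only: exI[of _ a.adjoin] simp_thms)
qed

subsection \<open>The subfield of fixed elements\<close>

lemma arithmetic_map_subset:
  assumes "arithmetic_map K B f" "A \<subseteq> B"
  shows "arithmetic_map K A f"
  using assms unfolding arithmetic_map_def by (auto simp: Pi_iff subset_iff)

text \<open>A witness set stays a witness when enlarged, so the witnesses of several elements can be
  united.\<close>

lemma fixed_elementsE: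
  assumes "r \<in> fixed_elements K"
  obtains A where "finite A" "A \<subseteq> carrier K" "r \<in> A"
    "\<And>B f. A \<subseteq> B \<Longrightarrow> arithmetic_map K B f \<Longrightarrow> f r = r"
proof -
  obtain A where A: "finite A" "A \<subseteq> carrier K" "r \<in> A" "\<forall>f. arithmetic_map K A f \<longrightarrow> f r = r"
    using assms unfolding fixed_elements_def arithmetically_fixed_def by blast
  show ?thesis
  proof (rule that[OF A(1-3)])
    fix B f assume "A \<subseteq> B" "arithmetic_map K B f"
    then show "f r = r"
      using mp[OF spec[OF A(4)], OF arithmetic_map_subset] by (simp only:)
  qed
qed

lemma fixed_elementsI:
  assumes "finite A" "A \<subseteq> carrier K" "r \<in> A" "\<And>f. arithmetic_map K A f \<Longrightarrow> f r = r"
  shows "r \<in> fixed_elements K"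
  using assms unfolding fixed_elements_def arithmetically_fixed_def by blast

lemma arithmetic_mapD:
  assumes "arithmetic_map K A f"
  shows "a \<in> A \<Longrightarrow> f a \<in> carrier K"
    and "\<one>\<^bsub>K\<^esub> \<in> A \<Longrightarrow> f \<one>\<^bsub>K\<^esub> = \<one>\<^bsub>K\<^esub>"
    and "a \<in> A \<Longrightarrow> b \<in> A \<Longrightarrow> a \<oplus>\<^bsub>K\<^esub> b \<in> A \<Longrightarrow> f (a \<oplus>\<^bsub>K\<^esub> b) = f a \<oplus>\<^bsub>K\<^esub> f b"
    and "a \<in> A \<Longrightarrow> b \<in> A \<Longrightarrow> a \<otimes>\<^bsub>K\<^esub> b \<in> A \<Longrightarrow> f (a \<otimes>\<^bsub>K\<^esub> b) = f a \<otimes>\<^bsub>K\<^esub> f b"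
  using assms unfolding arithmetic_map_def by auto

context field
begin

text \<open>The result of an operation is witnessed by the united witnesses of its arguments
  together with the result itself, plus \<open>0\<close> for negatives and \<open>1\<close> for
  inverses: the operation equation then lies inside the set.\<close>

lemma subfield_fixed_elements: "subfield (fixed_elements R) R"
proof (rule subfieldI')
  have one: "\<one> \<in> fixed_elements R"
    by (rule fixed_elementsI[of "{\<one>}"]) (auto dest: arithmetic_mapD(2))
  have zero: "\<zero> \<in> fixed_elements R"
  proof (rule fixed_elementsI[of "{\<zero>}"])
    fix f assume f: "arithmetic_map R {\<zero>} f"
    have c: "f \<zero> \<in> carrier R"
      by (rule arithmetic_mapD(1)[OF f]) simp
    \<comment> \<open>The equation \<open>0 + 0 = 0\<close> lives inside the singleton, and
      cancellation yields \<open>f 0 = 0\<close>.\<close>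
    have "f (\<zero> \<oplus> \<zero>) = f \<zero> \<oplus> f \<zero>"
      by (rule arithmetic_mapD(3)[OF f]) simp_all
    then have "f \<zero> \<oplus> f \<zero> = f \<zero> \<oplus> \<zero>"
      by (simp only: l_zero[OF zero_closed] r_zero[OF c])
    then show "f \<zero> = \<zero>"
      by (rule add.l_cancel[OF _ c zero_closed c])
  qed auto
  show "subring (fixed_elements R) R"
  proof (rule subringI[OF _ one])
    show "fixed_elements R \<subseteq> carrier R"
      by (auto simp: fixed_elements_def)
  next
    fix a assume a: "a \<in> fixed_elements R"
    then obtain A where A: "finite A" "A \<subseteq> carrier R" "a \<in> A"
      "\<And>B f. A \<subseteq> B \<Longrightarrow> arithmetic_map R B f \<Longrightarrow> f a = a"
      by (rule fixed_elementsE) (rule that)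
    obtain Z where Z: "finite Z" "Z \<subseteq> carrier R" "\<zero> \<in> Z"
      "\<And>B f. Z \<subseteq> B \<Longrightarrow> arithmetic_map R B f \<Longrightarrow> f \<zero> = \<zero>"
      using zero by (rule fixed_elementsE) (rule that)
    have aR: "a \<in> carrier R"
      using A by auto
    show "\<ominus> a \<in> fixed_elements R"
    proof (rule fixed_elementsI[of "insert (\<ominus> a) (A \<union> Z)"])
      fix f assume f: "arithmetic_map R (insert (\<ominus> a) (A \<union> Z)) f"
      have sum: "f (\<ominus> a \<oplus> a) = f (\<ominus> a) \<oplus> f a"
        by (rule arithmetic_mapD(3)[OF f]) (use A(3) Z(3) aR in \<open>simp_all add: l_neg\<close>)
      have fa: "f a = a"
        by (rule A(4)[OF _ f]) (rule subset_insertI2, rule Un_upper1)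
      have f0: "f \<zero> = \<zero>"
        by (rule Z(4)[OF _ f]) (rule subset_insertI2, rule Un_upper2)
      have s0: "f (\<ominus> a) \<oplus> a = \<zero>"
        using sum[symmetric] by (simp only: fa f0 l_neg[OF aR])
      have c: "f (\<ominus> a) \<in> carrier R"
        by (rule arithmetic_mapD(1)[OF f]) simp
      show "f (\<ominus> a) = \<ominus> a"
        by (rule minus_equality[OF s0 aR c, symmetric])
    qed (use A(1-3) Z(1-3) aR in auto)
  next
    fix a b assume a: "a \<in> fixed_elements R" and b: "b \<in> fixed_elements R"
    from a obtain A where A: "finite A" "A \<subseteq> carrier R" "a \<in> A"
      "\<And>C f. A \<subseteq> C \<Longrightarrow> arithmetic_map R C f \<Longrightarrow> f a = a"
      by (rule fixed_elementsE) (rule that)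
    from b obtain B where B: "finite B" "B \<subseteq> carrier R" "b \<in> B"
      "\<And>C f. B \<subseteq> C \<Longrightarrow> arithmetic_map R C f \<Longrightarrow> f b = b"
      by (rule fixed_elementsE) (rule that)
    show "a \<otimes> b \<in> fixed_elements R"
    proof (rule fixed_elementsI[of "insert (a \<otimes> b) (A \<union> B)"])
      fix f assume f: "arithmetic_map R (insert (a \<otimes> b) (A \<union> B)) f"
      have "f a = a"
        by (rule A(4)[OF _ f]) (rule subset_insertI2, rule Un_upper1)
      moreover have "f b = b"
        by (rule B(4)[OF _ f]) (rule subset_insertI2, rule Un_upper2)
      moreover have "f (a \<otimes> b) = f a \<otimes> f b"
        by (rule arithmetic_mapD(4)[OF f]) (use A(3) B(3) in simp_all)
      ultimately show "f (a \<otimes> b) = a \<otimes> b"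
        by (simp only:)
    qed (use A(1-3) B(1-3) in auto)
    show "a \<oplus> b \<in> fixed_elements R"
    proof (rule fixed_elementsI[of "insert (a \<oplus> b) (A \<union> B)"])
      fix f assume f: "arithmetic_map R (insert (a \<oplus> b) (A \<union> B)) f"
      have "f a = a"
        by (rule A(4)[OF _ f]) (rule subset_insertI2, rule Un_upper1)
      moreover have "f b = b"
        by (rule B(4)[OF _ f]) (rule subset_insertI2, rule Un_upper2)
      moreover have "f (a \<oplus> b) = f a \<oplus> f b"
        by (rule arithmetic_mapD(3)[OF f]) (use A(3) B(3) in simp_all)
      ultimately show "f (a \<oplus> b) = a \<oplus> b"
        by (simp only:)
    qed (use A(1-3) B(1-3) in auto)
  qed
  fix a assume a: "a \<in> fixed_elements R - {\<zero>}"
  then have "a \<in> fixed_elements R"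
    by simp
  then obtain A where A: "finite A" "A \<subseteq> carrier R" "a \<in> A"
    "\<And>B f. A \<subseteq> B \<Longrightarrow> arithmetic_map R B f \<Longrightarrow> f a = a"
    by (rule fixed_elementsE) (rule that)
  have aU: "a \<in> carrier R" "a \<in> Units R"
    using A(2,3) a by (auto simp: field_Units)
  show "inv a \<in> fixed_elements R"
  proof (rule fixed_elementsI[of "insert (inv a) (insert \<one> A)"])
    fix f assume f: "arithmetic_map R (insert (inv a) (insert \<one> A)) f"
    have fa: "f a = a"
      by (rule A(4)[OF _ f]) (intro subset_insertI2 subset_refl)
    have f1: "f \<one> = \<one>"
      by (rule arithmetic_mapD(2)[OF f]) simp
    have prod: "f (inv a \<otimes> a) = f (inv a) \<otimes> f a"
      by (rule arithmetic_mapD(4)[OF f]) (use A(3) aU in simp_all)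
    have "f (inv a) \<otimes> a = \<one>"
      using prod[symmetric] by (simp only: fa f1 Units_l_inv[OF aU(2)])
    moreover have "f (inv a) \<in> carrier R"
      by (rule arithmetic_mapD(1)[OF f]) simp
    ultimately have "inv a = f (inv a)"
      using aU by (intro comm_inv_char) (simp_all add: m_comm)
    then show "f (inv a) = inv a" by (rule sym)
  qed (use A(1-3) aU in auto)
qed

lemma subfield_prime_field: "subfield (prime_field R) R"
proof (rule subfieldI')
  show "subring (prime_field R) R"
    unfolding prime_field_def
    by (rule subring_Inter) (use subfieldE(1) carrier_is_subfield in auto)
  fix a assume "a \<in> prime_field R - {\<zero>}"
  then show "inv a \<in> prime_field R"
    unfolding prime_field_def using subfield_m_inv(1) by auto
qed

lemma prime_field_subset: "subfield F R \<Longrightarrow> prime_field R \<subseteq> F"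
  by (auto simp: prime_field_def)

end

lemma (in ring) subring_add_pow:
  assumes "subring H R" "a \<in> H"
  shows "[(n::nat)] \<cdot> a \<in> H"
proof (induction n)
  case 0
  show ?case using subringE(2)[OF assms(1)] by simp
next
  case (Suc n)
  then show ?case using subringE(7)[OF assms(1) _ assms(2)] by simp
qed

subsection \<open>Roots of polynomials\<close>

context UP_domain
begin

text \<open>The remainder theorem with vanishing remainder; \<open>X - a\<close> is written as
  \<open>X + (-a)\<close> to match \<open>coeff_linear_mult\<close>.\<close>

lemma root_factor:
  assumes f: "f \<in> carrier P" and a: "a \<in> carrier R" "UnivPoly.eval R R id a f = \<zero>"
  obtains q where "q \<in> carrier P" "f = (up_ring.monom P \<one> (Suc 0) \<oplus>\<^bsub>P\<^esub> up_ring.monom P (\<ominus> a) 0) \<otimes>\<^bsub>P\<^esub> q"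
proof -
  have "carrier R \<noteq> {\<zero>}"
    using R.one_not_zero R.one_closed by blast
  from remainder_theorem[OF f a(1) this]
  obtain q where "q \<in> carrier P"
    "f = (up_ring.monom P \<one> 1 \<ominus>\<^bsub>P\<^esub> up_ring.monom P a 0) \<otimes>\<^bsub>P\<^esub> q \<oplus>\<^bsub>P\<^esub> up_ring.monom P (UnivPoly.eval R R id a f) 0"
    by (elim exE conjE)
  then have "q \<in> carrier P" "f = (up_ring.monom P \<one> (Suc 0) \<oplus>\<^bsub>P\<^esub> up_ring.monom P (\<ominus> a) 0) \<otimes>\<^bsub>P\<^esub> q"
    using a by (simp_all add: a_minus_def)
  then show ?thesis
    by (rule that)
qed

lemma eval_linear_mult:
  assumes "q \<in> carrier P" "a \<in> carrier R" "t \<in> carrier R"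
  shows "UnivPoly.eval R R id t ((up_ring.monom P \<one> (Suc 0) \<oplus>\<^bsub>P\<^esub> up_ring.monom P (\<ominus> a) 0) \<otimes>\<^bsub>P\<^esub> q)
    = (t \<ominus> a) \<otimes> UnivPoly.eval R R id t q"
proof -
  interpret E: UP_pre_univ_prop R R id P by unfold_locales simp
  interpret H: ring_hom_cring P R "UnivPoly.eval R R id t"
    by unfold_locales (rule E.eval_ring_hom[OF assms(3)])
  show ?thesis
    using assms E.eval_monom[of \<one> t "Suc 0"] by (simp add: E.eval_const a_minus_def del: monom_a_inv)
qed

lemma deg_linear_mult:
  assumes "q \<in> carrier P" "q \<noteq> \<zero>\<^bsub>P\<^esub>" "a \<in> carrier R"
  shows "deg R ((up_ring.monom P \<one> (Suc 0) \<oplus>\<^bsub>P\<^esub> up_ring.monom P (\<ominus> a) 0) \<otimes>\<^bsub>P\<^esub> q) = Suc (deg R q)"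
    (is "deg R (?l \<otimes>\<^bsub>P\<^esub> q) = _")
proof -
  have l: "?l \<in> carrier P"
    using assms by simp
  have "deg R ?l = 1"
    using deg_minus_eq assms(3)
    by (intro le_antisym deg_aboveI deg_belowI) (use assms in auto)
  moreover from this have "?l \<noteq> \<zero>\<^bsub>P\<^esub>"
    by (intro deg_nzero_nzero) simp
  ultimately show ?thesis
    using deg_mult[OF _ assms(2) l assms(1)] by simp
qed

text \<open>Splitting off the factor of one root lowers the degree by one and leaves the other roots
  as roots of the cofactor.\<close>

lemma card_roots_le_deg:
  assumes "f \<in> carrier P" "f \<noteq> \<zero>\<^bsub>P\<^esub>" "finite T" "T \<subseteq> carrier R" "\<And>t. t \<in> T \<Longrightarrow> UnivPoly.eval R R id t f = \<zero>"
  shows "card T \<le> deg R f"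
  using assms(3,1,2,4,5)
proof (induction T arbitrary: f rule: finite_induct)
  case empty
  show ?case by simp
next
  case (insert a T)
  have a: "a \<in> carrier R" "UnivPoly.eval R R id a f = \<zero>"
    using insert.prems(3) by simp (rule insert.prems(4), simp)
  obtain q where q: "q \<in> carrier P" and f: "f = (up_ring.monom P \<one> (Suc 0) \<oplus>\<^bsub>P\<^esub> up_ring.monom P (\<ominus> a) 0) \<otimes>\<^bsub>P\<^esub> q"
    by (rule root_factor[OF insert.prems(1) a])
  interpret E: UP_pre_univ_prop R R id P by unfold_locales simp
  have "q \<noteq> \<zero>\<^bsub>P\<^esub>"
    using insert.prems(2) a(1) unfolding f by fastforce
  have "UnivPoly.eval R R id t q = \<zero>" if t: "t \<in> T" for t
  proof -
    have tc: "t \<in> carrier R" "t \<noteq> a"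
      using insert.prems(3) insert.hyps t by auto
    have "UnivPoly.eval R R id t f = \<zero>"
      by (rule insert.prems(4)) (simp add: t)
    then have "(t \<ominus> a) \<otimes> UnivPoly.eval R R id t q = \<zero>"
      by (simp only: f eval_linear_mult[OF q a(1) tc(1)])
    moreover have "UnivPoly.eval R R id t q \<in> carrier R"
      using ring_hom_closed[OF E.eval_ring_hom[OF tc(1)] q] .
    ultimately show ?thesis
      using tc a(1) R.integral[of "t \<ominus> a" "UnivPoly.eval R R id t q"] by simp
  qed
  moreover have "T \<subseteq> carrier R"
    using insert.prems(3) by simp
  ultimately have "card T \<le> deg R q"
    using insert.IH[OF q \<open>q \<noteq> _\<close>] by (simp only:)
  then show ?case
    using insert.hyps deg_linear_mult[OF q \<open>q \<noteq> _\<close> a(1)] f by simp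
qed

end

text \<open>If \<open>s\<close> is the only root, then \<open>f = c (X - s)^(m+1)\<close>, whose
  coefficient of \<open>X^m\<close> is \<open>-(m+1) c s\<close>. This replaces a derivative
  argument for separability.\<close>

lemma (in algebraically_closed) single_root_subleading_coeff:
  assumes "f \<in> carrier (UP L)" "deg L f = Suc m"
    and "\<forall>t\<in>carrier L. UnivPoly.eval L L id t f = \<zero> \<longrightarrow> t = s"
  shows "s \<in> carrier L \<and> up_ring.coeff (UP L) f m \<oplus> [Suc m] \<cdot> (up_ring.coeff (UP L) f (Suc m) \<otimes> s) = \<zero>"
  using assms
proof (induction m arbitrary: f)
  interpret U: UP_domain L "UP L" by unfold_locales
  \<comment> \<open>Peeling off one factor \<open>X - s\<close> serves both the base case and the
    induction step: the cofactor again has no root other than \<open>s\<close>.\<close>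
  {
    fix f m
    assume f: "f \<in> carrier (UP L)" "deg L f = Suc m"
      "\<forall>t\<in>carrier L. UnivPoly.eval L L id t f = \<zero> \<longrightarrow> t = s"
    have "deg L f \<noteq> 0" using f(2) by simp
    obtain t where t: "t \<in> carrier L" "UnivPoly.eval L L id t f = \<zero>"
      by (rule algebraically_closed_root[OF algebraically_closed_axioms is_cring id_ring_hom f(1) \<open>deg L f \<noteq> 0\<close>])
        (use U.lcoeff_nonzero_deg[OF \<open>deg L f \<noteq> 0\<close> f(1)] that in simp_all)
    then have s: "s \<in> carrier L" "UnivPoly.eval L L id s f = \<zero>"
      using f(3) by metis+
    obtain q where q: "q \<in> carrier (UP L)"
      "f = (up_ring.monom (UP L) \<one> (Suc 0) \<oplus>\<^bsub>UP L\<^esub> up_ring.monom (UP L) (\<ominus> s) 0) \<otimes>\<^bsub>UP L\<^esub> q"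
      by (rule U.root_factor[OF f(1) s])
    have "q \<noteq> \<zero>\<^bsub>UP L\<^esub>"
      using f(2) q(2) s(1) by fastforce
    then have d: "deg L q = m"
      using U.deg_linear_mult[OF q(1) _ s(1)] q(2) f(2) by simp
    have "t = s" if "t \<in> carrier L" "UnivPoly.eval L L id t q = \<zero>" for t
      using bspec[OF f(3) that(1)] U.eval_linear_mult[OF q(1) s(1) that(1)] q(2) that s(1) by simp
    with s(1) q d have "\<exists>q. s \<in> carrier L \<and> q \<in> carrier (UP L) \<and>
      f = (up_ring.monom (UP L) \<one> (Suc 0) \<oplus>\<^bsub>UP L\<^esub> up_ring.monom (UP L) (\<ominus> s) 0) \<otimes>\<^bsub>UP L\<^esub> q \<and> deg L q = m \<and>
      (\<forall>t\<in>carrier L. UnivPoly.eval L L id t q = \<zero> \<longrightarrow> t = s)"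
      by metis
  }
  note factor = this
  {
    case (0 f)
    from factor[OF 0] obtain q where q: "s \<in> carrier L" "q \<in> carrier (UP L)"
      "f = (up_ring.monom (UP L) \<one> (Suc 0) \<oplus>\<^bsub>UP L\<^esub> up_ring.monom (UP L) (\<ominus> s) 0) \<otimes>\<^bsub>UP L\<^esub> q" "deg L q = 0"
      by (elim exE conjE)
    let ?c = "up_ring.coeff (UP L) q 0"
    have c: "?c \<in> carrier L"
      using q(2) by simp
    have lin: "up_ring.coeff (UP L) f (Suc n) = up_ring.coeff (UP L) q n \<oplus> \<ominus> s \<otimes> up_ring.coeff (UP L) q (Suc n)" for n
      unfolding q(3) by (rule U.coeff_linear_mult(1)) (use q(1,2) in simp_all)
    have "up_ring.coeff (UP L) f 0 = \<ominus> s \<otimes> ?c"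
      unfolding q(3) by (rule U.coeff_linear_mult(2)) (use q(1,2) in simp_all)
    moreover have "up_ring.coeff (UP L) f (Suc 0) = ?c"
      using lin[of 0] c q(1,2,4) U.deg_aboveD[of q "Suc 0"] by simp
    ultimately    show ?case
      using c q(1) by (simp add: l_minus m_comm l_neg)
  next
    case (Suc m f)
    from factor[OF Suc.prems] obtain q where q: "s \<in> carrier L" "q \<in> carrier (UP L)"
      "f = (up_ring.monom (UP L) \<one> (Suc 0) \<oplus>\<^bsub>UP L\<^esub> up_ring.monom (UP L) (\<ominus> s) 0) \<otimes>\<^bsub>UP L\<^esub> q" "deg L q = Suc m"
      and root: "\<forall>t\<in>carrier L. UnivPoly.eval L L id t q = \<zero> \<longrightarrow> t = s"
      by (elim exE conjE)
    let ?c = "up_ring.coeff (UP L) q (Suc m)" and ?d = "up_ring.coeff (UP L) q m"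
    have c: "?c \<in> carrier L" "?d \<in> carrier L"
      using q(2) by simp_all
    have lin: "up_ring.coeff (UP L) f (Suc n) = up_ring.coeff (UP L) q n \<oplus> \<ominus> s \<otimes> up_ring.coeff (UP L) q (Suc n)" for n
      unfolding q(3) by (rule U.coeff_linear_mult(1)) (use q(1,2) in simp_all)
    note lin[of m]
    moreover have "up_ring.coeff (UP L) f (Suc (Suc m)) = ?c"
      using lin[of "Suc m"] c q(1,2,4) U.deg_aboveD[of q "Suc (Suc m)"] by simp
    moreover have "?d \<oplus> [Suc m] \<cdot> (?c \<otimes> s) = \<zero>"
      using Suc.IH[OF q(2,4) root] by (elim conjE)
    \<comment> \<open>The new factor contributes \<open>-c s\<close> to the subleading coefficient,
      balanced by the multiple growing from \<open>m + 1\<close> to \<open>m + 2\<close>.\<close>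
    moreover have "(?d \<oplus> \<ominus> s \<otimes> ?c) \<oplus> ([Suc m] \<cdot> (?c \<otimes> s) \<oplus> ?c \<otimes> s) = (?d \<oplus> [Suc m] \<cdot> (?c \<otimes> s)) \<oplus> (\<ominus> (?c \<otimes> s) \<oplus> ?c \<otimes> s)"
      using c q(1) by (simp add: l_minus m_comm a_ac del: add.nat_pow_Suc)
    moreover have "[Suc (Suc m)] \<cdot> (?c \<otimes> s) = [Suc m] \<cdot> (?c \<otimes> s) \<oplus> ?c \<otimes> s"
      by simp
    ultimately show ?case
      using c q(1) by (simp add: l_neg)
  }
qed

subsection \<open>Positive characteristic\<close>

context field
begin

text \<open>A factorisation \<open>p = m k\<close> makes the product of the multiples
  \<open>m 1\<close> and \<open>k 1\<close> vanish; in a domain one of them is zero, so leastness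
  makes that factor all of \<open>p\<close>.\<close>

lemma char_prime:
  assumes p: "(p::nat) > 0" "[p] \<cdot> \<one> = \<zero>" and least: "\<And>n. 0 < n \<Longrightarrow> n < p \<Longrightarrow> [n] \<cdot> \<one> \<noteq> \<zero>"
  shows "prime p"
  unfolding prime_nat_iff
proof (intro conjI allI impI)
  have "p \<noteq> 1"
    using p(2) one_not_zero by auto
  with p(1) show "1 < p" by simp
  fix m assume "m dvd p"
  then obtain k where k: "p = m * k" ..
  then have pos: "0 < m" "0 < k"
    using p(1) by auto
  have "[m] \<cdot> \<one> \<otimes> [k] \<cdot> \<one> = [p] \<cdot> \<one>"
    by (simp add: k add_pow_ldistr add.nat_pow_pow mult.commute)
  then have "[m] \<cdot> \<one> = \<zero> \<or> [k] \<cdot> \<one> = \<zero>"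
    using p(2) integral[of "[m] \<cdot> \<one>" "[k] \<cdot> \<one>"] by simp
  moreover have "m \<le> p" "k \<le> p"
    using k pos by simp_all
  ultimately have "m = p \<or> k = p"
    using least[OF pos(1)] least[OF pos(2)] le_neq_implies_less by metis
  then show "m = 1 \<or> m = p"
    using k p(1) by auto
qed

text \<open>The multiples of \<open>1\<close> are already \<open>p\<close> distinct roots of
  \<open>X^p - X\<close>; an \<open>r\<close> outside the prime field would be one root too
  many.\<close>

lemma frobenius_fixed_prime_field:
  assumes p: "prime (p::nat)" "[p] \<cdot> \<one> = \<zero>" and least: "\<And>n. 0 < n \<Longrightarrow> n < p \<Longrightarrow> [n] \<cdot> \<one> \<noteq> \<zero>"
    and r: "r \<in> carrier R" "r [^] p = r"
  shows "r \<in> prime_field R"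
proof (rule ccontr)
  assume r': "r \<notin> prime_field R"
  interpret U: UP_domain R "UP R" by unfold_locales
  have p1: "1 < p"
    using p(1) by (rule prime_gt_1_nat)
  let ?n = "\<lambda>n::nat. [n] \<cdot> \<one>"
  let ?T = "?n ` {..<p}"
  let ?f = "up_ring.monom (UP R) \<one> p \<ominus>\<^bsub>UP R\<^esub> up_ring.monom (UP R) \<one> (Suc 0)"
  have sub: "subring (prime_field R) R"
    by (rule subfieldE(1)[OF subfield_prime_field])
  have T: "?T \<subseteq> prime_field R"
    using subring_add_pow[OF sub subringE(3)[OF sub]] by auto
  \<comment> \<open>Were \<open>m > n\<close>, then \<open>m - n\<close> would be a positive number
    below \<open>p\<close> annihilating \<open>1\<close>.\<close>
  have le: "m \<le> n" if "?n m = ?n n" "m < p" for m n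
  proof (rule ccontr)
    assume "\<not> m \<le> n"
    then have "m = n + (m - n)" "0 < m - n" by simp_all
    then have "?n m = ?n n \<oplus> ?n (m - n)"
      by (metis add.nat_pow_mult one_closed)
    then have "?n (m - n) = \<zero>"
      using that(1) by (metis add.l_cancel_one add.nat_pow_closed one_closed)
    moreover have "m - n < p"
      using that(2) by simp
    ultimately show False
      using least[OF \<open>0 < m - n\<close>] by simp
  qed
  have inj: "inj_on ?n {..<p}"
  proof (rule inj_onI)
    fix m n assume "m \<in> {..<p}" "n \<in> {..<p}" "?n m = ?n n"
    then show "m = n"
      using le[of m n] le[of n m] by simp
  qed
  have frob: "(?n n) [^] p = ?n n" for n
  proof (induction n)
    case 0
    show ?case using p1 by (simp add: nat_pow_zero)
  next
    case (Suc n)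
    then show ?case
      using freshmans_dream[OF p, of "?n n" \<one>] by simp
  qed
  have f: "?f \<in> carrier (UP R)"
    by simp
  have "up_ring.coeff (UP R) ?f p = \<one>"
    using p1 by (simp add: a_minus_def)
  then have f0: "?f \<noteq> \<zero>\<^bsub>UP R\<^esub>"
    using one_not_zero U.coeff_zero[of p] by metis
  have d: "deg R ?f \<le> p"
    by (rule U.deg_aboveI[OF _ f]) (use p1 in \<open>simp add: a_minus_def\<close>)
  have root: "UnivPoly.eval R R id t ?f = \<zero>" if "t \<in> insert r ?T" for t
  proof -
    have t: "t \<in> carrier R" "t [^] p = t"
      using that r frob by auto
    interpret E: UP_pre_univ_prop R R id "UP R" by unfold_locales simp
    interpret H: ring_hom_cring "UP R" R "UnivPoly.eval R R id t"
      by unfold_locales (rule E.eval_ring_hom[OF t(1)])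
    show ?thesis
      using t E.eval_monom[of \<one> t p] E.eval_monom[of \<one> t "Suc 0"] by (simp add: a_minus_def r_neg)
  qed
  have "insert r ?T \<subseteq> carrier R"
    using r(1) by auto
  then have "card (insert r ?T) \<le> deg R ?f"
    by (intro U.card_roots_le_deg[OF f f0 _ _ root]) simp_all
  moreover have "card (insert r ?T) = Suc p"
    using card_image[OF inj] T r' by (subst card_insert_disjoint) auto
  ultimately show False
    using d by simp
qed

lemma fixed_elements_finite_char:
  assumes "(p::nat) > 0" "[p] \<cdot> \<one> = \<zero>"
  shows "fixed_elements R \<subseteq> prime_field R"
proof
  fix r assume "r \<in> fixed_elements R"
  then obtain A where A: "finite A" "A \<subseteq> carrier R" "r \<in> A"
    "\<And>B f. A \<subseteq> B \<Longrightarrow> arithmetic_map R B f \<Longrightarrow> f r = r"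
    by (rule fixed_elementsE) (rule that)
  \<comment> \<open>The given \<open>p\<close> is any positive number annihilating \<open>1\<close>;
    the least one is the characteristic.\<close>
  define q where "q = (LEAST n::nat. 0 < n \<and> [n] \<cdot> \<one> = \<zero>)"
  have q: "0 < q \<and> [q] \<cdot> \<one> = \<zero>"
    unfolding q_def by (rule LeastI[where P = "\<lambda>n. 0 < n \<and> [n] \<cdot> \<one> = \<zero>", OF conjI[OF assms]])
  note q = conjunct1[OF q] conjunct2[OF q]
  have least: "[n] \<cdot> \<one> \<noteq> \<zero>" if "0 < n" "n < q" for n
  proof
    assume "[n] \<cdot> \<one> = \<zero>"
    with that(1) have "0 < n \<and> [n] \<cdot> \<one> = \<zero>" by (rule conjI)
    with not_less_Least[OF that(2)[unfolded q_def]] show False by (rule notE)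
  qed
  have prime: "prime q"
    by (rule char_prime[OF q least])
  have "arithmetic_map R A (\<lambda>x. x [^] q)"
    unfolding arithmetic_map_def
  proof (intro conjI ballI impI)
    fix a b assume "a \<in> A" "b \<in> A"
    then have ab: "a \<in> carrier R" "b \<in> carrier R"
      by (simp_all only: subsetD[OF A(2)])
    show "(a \<oplus> b) [^] q = a [^] q \<oplus> b [^] q"
      by (rule freshmans_dream[OF prime q(2) ab])
    show "(a \<otimes> b) [^] q = a [^] q \<otimes> b [^] q"
      by (rule nat_pow_distrib[OF ab])
  next
    show "(\<lambda>x. x [^] q) \<in> A \<rightarrow> carrier R"
      by (intro Pi_I nat_pow_closed) (rule subsetD[OF A(2)])
  qed (rule nat_pow_one)
  then have rr: "r [^] q = r"
    by (rule A(4)[OF subset_refl])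
  show "r \<in> prime_field R"
    by (rule frobenius_fixed_prime_field[OF prime q(2) _ subsetD[OF A(2,3)] rr]) (rule least)
qed

end

lemma add_pow_carrier_update: "add_pow (K\<lparr>carrier := F\<rparr>) = (add_pow K :: nat \<Rightarrow> _)"
  by (simp add: add_pow_def nat_pow_def fun_eq_iff)

subsection \<open>Characteristic zero\<close>

text \<open>The inclusion of \<open>k\<close> in \<open>F\<close> is extended to
  \<open>k[r]\<close>. The element \<open>c\<close> is the obstruction that must survive for a
  further extension over the witness set.\<close>

lemma (in field) exists_hom_moving_element:
  assumes F: "subfield F R" and ac: "algebraically_closed (R\<lparr>carrier := F\<rparr>)"
    and char: "\<And>n. 0 < n \<Longrightarrow> [(n::nat)] \<cdot> \<one> \<noteq> \<zero>"
    and k: "subfield k R" "k \<subseteq> F" and r: "r \<in> carrier R" "r \<notin> k"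
    and c: "c \<in> subring_adjoin.adjoin R k r" "c \<noteq> \<zero>"
  obtains h where "h \<in> ring_hom (R\<lparr>carrier := subring_adjoin.adjoin R k r\<rparr>) (R\<lparr>carrier := F\<rparr>)"
    "h r \<noteq> r" "h c \<noteq> \<zero>"
proof -
  let ?L = "R\<lparr>carrier := F\<rparr>"
  interpret L: algebraically_closed ?L by fact
  interpret a: subring_adjoin R k r
    by (intro subring_adjoin.intro subring_adjoin_axioms.intro domain_axioms subfieldE(1)[OF k(1)] r(1))
  have id: "id \<in> ring_hom a.KR ?L"
    using k(2) by (intro ring_hom_memI) (simp_all add: subset_eq)
  show ?thesis
  proof (cases "\<exists>p. a.minimal_relation p")
    case False
    have tr: "p = \<zero>\<^bsub>UP a.KR\<^esub>" if "p \<in> carrier (UP a.KR)" "UnivPoly.eval a.KR R id r p = \<zero>" for p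
      using a.minimal_relation_exists[OF that(1) _ that(2)] False by blast
    show ?thesis
    proof (rule a.transcendental_hom_nonzero[OF tr ac c])
      fix d assume d: "d \<in> k" "d \<noteq> \<zero>" and ext: "\<And>h s. h \<in> ring_hom a.KR ?L \<Longrightarrow> h d \<noteq> \<zero>\<^bsub>?L\<^esub> \<Longrightarrow>
        \<exists>g\<in>ring_hom (R\<lparr>carrier := a.adjoin\<rparr>) ?L. (\<forall>a\<in>k. g a = h a) \<and> g r \<noteq> s \<and> g c \<noteq> \<zero>\<^bsub>?L\<^esub>"
      have "id d \<noteq> \<zero>\<^bsub>?L\<^esub>"
        using d by simp
      \<comment> \<open>The value to be avoided is \<open>r\<close> itself.\<close>
      from ext[OF id this, of r] obtain g where "g \<in> ring_hom (R\<lparr>carrier := a.adjoin\<rparr>) ?L" "g r \<noteq> r" "g c \<noteq> \<zero>\<^bsub>?L\<^esub>"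
        by (elim bexE conjE)
      then show ?thesis
        by (intro that[of g]) simp_all
    qed
  next
    case True
    then obtain p where p: "a.minimal_relation p" by (elim exE)
    then have pc: "p \<in> carrier (UP a.KR) \<and> p \<noteq> \<zero>\<^bsub>UP a.KR\<^esub>"
      unfolding a.minimal_relation_def by (elim conjE, intro conjI)
    note pc = conjunct1[OF pc] conjunct2[OF pc]
    obtain m where m: "deg a.KR p = Suc m"
      using not0_implies_Suc[OF a.minimal_relation_deg[OF p]] by (elim exE)
    let ?c = "up_ring.coeff (UP a.KR) p"
    have ck: "?c n \<in> k" for n
      using a.U.coeff_closed[OF pc(1), of n] by simp
    have lc: "?c (Suc m) \<noteq> \<zero>"
      using a.U.lcoeff_nonzero[OF pc(2,1)] m by simp
    \<comment> \<open>If \<open>r\<close> were the only root, then \<open>p = a (X - r)^(m+1)\<close>, and its coefficient of \<open>X^m\<close>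
      would put \<open>(m+1) a r\<close> into \<open>k\<close>.\<close>
    have "\<exists>t. t \<in> F \<and> UnivPoly.eval a.KR ?L id t p = \<zero> \<and> t \<noteq> r"
    proof (rule ccontr)
      assume only: "\<not> ?thesis"
      have lc': "id (?c (deg a.KR p)) \<noteq> \<zero>\<^bsub>?L\<^esub>"
        using lc m by simp
      obtain q where q: "q \<in> carrier (UP ?L)" "\<And>n. up_ring.coeff (UP ?L) q n = id (?c n)"
        "deg ?L q = deg a.KR p" "\<And>t. UnivPoly.eval ?L ?L id t q = UnivPoly.eval a.KR ?L id t p"
        by (rule map_UP[OF a.U.R.is_cring L.is_cring id pc(1) lc'], rule that)
      have root: "\<forall>t\<in>carrier ?L. UnivPoly.eval ?L ?L id t q = \<zero>\<^bsub>?L\<^esub> \<longrightarrow> t = r"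
      proof (intro ballI impI)
        fix t assume "t \<in> carrier ?L" "UnivPoly.eval ?L ?L id t q = \<zero>\<^bsub>?L\<^esub>"
        then have "t \<in> F" "UnivPoly.eval a.KR ?L id t p = \<zero>"
          unfolding q(4) by simp_all
        with only show "t = r" by blast
      qed
      have dq: "deg ?L q = Suc m"
        unfolding q(3) by (rule m)
      have eq: "?c m \<oplus> [Suc m] \<cdot> (?c (Suc m) \<otimes> r) = \<zero>"
        using conjunct2[OF L.single_root_subleading_coeff[OF q(1) dq root]]
        unfolding q(2) add_pow_carrier_update by (simp del: add.nat_pow_Suc)
      \<comment> \<open>\<open>u\<close> is \<open>m + 1\<close> times the leading coefficient,
        nonzero by characteristic zero. It is invertible in \<open>k\<close>, so \<open>u r\<close>
        in \<open>k\<close> forces \<open>r\<close> in \<open>k\<close>.\<close>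
      let ?u = "[Suc m] \<cdot> (?c (Suc m))"
      have cR: "?c n \<in> carrier R" for n
        by (rule subsetD[OF subfieldE(3)[OF k(1)] ck])
      have uR: "?u \<in> carrier R"
        by (rule add.nat_pow_closed[OF cR])
      have "?u = [Suc m] \<cdot> \<one> \<otimes> ?c (Suc m)"
        using add_pow_ldistr[OF one_closed cR, of "Suc m" "Suc m"] l_one[OF cR] by (simp only:)
      then have "?u \<noteq> \<zero>"
        using integral[OF _ add.nat_pow_closed[OF one_closed, of "Suc m"] cR[of "Suc m"]] char[OF zero_less_Suc, of m] lc
        by (simp only:) blast
      then have u: "?u \<in> k - {\<zero>}"
        using subring_add_pow[OF subfieldE(1)[OF k(1)] ck, of "Suc m"] by simp
      have "?u \<otimes> r = \<ominus> ?c m"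
      proof -
        have "?c m \<oplus> ?u \<otimes> r = \<zero>"
          using eq by (simp only: add_pow_ldistr[OF cR r(1)])
        then have "?u \<otimes> r \<oplus> ?c m = \<zero>"
          by (subst a_comm[OF m_closed[OF uR r(1)] cR])
        from minus_equality[OF this cR m_closed[OF uR r(1)]] show ?thesis by (rule sym)
      qed
      then have "?u \<otimes> r \<in> k"
        using subringE(5)[OF subfieldE(1)[OF k(1)] ck] by (simp only:)
      then have "r \<in> k"
        by (rule subfield_m_inv_simprule[OF k(1) u r(1)])
      with r(2) show False by (rule notE)
    qed
    then obtain t where "t \<in> F" "UnivPoly.eval a.KR ?L id t p = \<zero>" "t \<noteq> r"
      by (elim exE conjE)
    then have t: "t \<in> carrier ?L" "UnivPoly.eval a.KR ?L id t p = \<zero>\<^bsub>?L\<^esub>" "t \<noteq> r"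
      by simp_all
    show ?thesis
    proof (rule a.algebraic_hom_nonzero[OF p L.domain_axioms c])
      fix d assume d: "d \<in> k" "d \<noteq> \<zero>" and
        ext: "\<And>h t. h \<in> ring_hom a.KR ?L \<Longrightarrow> h d \<noteq> \<zero>\<^bsub>?L\<^esub> \<Longrightarrow> t \<in> carrier ?L \<Longrightarrow> UnivPoly.eval a.KR ?L h t p = \<zero>\<^bsub>?L\<^esub> \<Longrightarrow>
        \<exists>g\<in>ring_hom (R\<lparr>carrier := a.adjoin\<rparr>) ?L. (\<forall>a\<in>k. g a = h a) \<and> g r = t \<and> g c \<noteq> \<zero>\<^bsub>?L\<^esub>"
      have "id d \<noteq> \<zero>\<^bsub>?L\<^esub>"
        using d by simp
      from ext[OF id this t(1,2)] obtain g where g: "g \<in> ring_hom (R\<lparr>carrier := a.adjoin\<rparr>) ?L" "g r = t" "g c \<noteq> \<zero>\<^bsub>?L\<^esub>"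
        by (elim bexE conjE)
      have "g r \<noteq> r"
        unfolding g(2) by (rule t(3))
      with g(1,3) show ?thesis
        by (intro that[of g]) simp_all
    qed
  qed
qed

lemma (in field) fixed_elements_char_zero:
  assumes F: "subfield F R" and ac: "algebraically_closed (R\<lparr>carrier := F\<rparr>)"
    and char: "\<And>n. 0 < n \<Longrightarrow> [(n::nat)] \<cdot> \<one> \<noteq> \<zero>"
  shows "fixed_elements R \<subseteq> prime_field R"
proof
  let ?L = "R\<lparr>carrier := F\<rparr>"
  fix r assume "r \<in> fixed_elements R"
  then obtain A where A: "finite A" "A \<subseteq> carrier R" "r \<in> A"
    "\<And>B f. A \<subseteq> B \<Longrightarrow> arithmetic_map R B f \<Longrightarrow> f r = r"
    by (rule fixed_elementsE) (rule that)
  have r: "r \<in> carrier R"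
    by (rule subsetD[OF A(2,3)])
  show "r \<in> prime_field R"
  proof (rule ccontr)
    assume r': "r \<notin> prime_field R"
    interpret a: subring_adjoin R "prime_field R" r
      by (intro subring_adjoin.intro subring_adjoin_axioms.intro domain_axioms subfieldE(1)[OF subfield_prime_field] r)
    obtain S where S: "subring S R" "a.adjoin \<subseteq> S" "A \<subseteq> S" "hom_extends R ?L a.adjoin S"
      using hom_extends_finite[OF ac a.subring_adjoin A(1,2)] by (elim exE conjE)
    \<comment> \<open>Only the existence of an extension matters now, so the element to be kept
      nonzero is taken to be \<open>1\<close>.\<close>
    have one: "\<one> \<in> S - {\<zero>}"
      using subringE(3)[OF S(1)] by simp
    obtain c where c: "c \<in> a.adjoin - {\<zero>}" and ext: "\<forall>h\<in>ring_hom (R\<lparr>carrier := a.adjoin\<rparr>) ?L. h c \<noteq> \<zero>\<^bsub>?L\<^esub> \<longrightarrow>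
       (\<exists>g\<in>ring_hom (R\<lparr>carrier := S\<rparr>) ?L. (\<forall>a\<in>a.adjoin. g a = h a) \<and> g \<one> \<noteq> \<zero>\<^bsub>?L\<^esub>)"
      using bspec[OF S(4)[unfolded hom_extends_def] one] by (elim bexE)
    have c': "c \<in> a.adjoin" "c \<noteq> \<zero>"
      using c by simp_all
    obtain h where h: "h \<in> ring_hom (R\<lparr>carrier := a.adjoin\<rparr>) ?L" "h r \<noteq> r" "h c \<noteq> \<zero>"
      by (rule exists_hom_moving_element[OF F ac char subfield_prime_field prime_field_subset[OF F] r r' c'], assumption, rule that)
    have "h c \<noteq> \<zero>\<^bsub>?L\<^esub>"
      using h(3) by simp
    from mp[OF bspec[OF ext h(1)] this]
    obtain g where g: "g \<in> ring_hom (R\<lparr>carrier := S\<rparr>) ?L" "\<forall>a\<in>a.adjoin. g a = h a"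
      by (elim bexE conjE)
    have "g r \<noteq> r"
      unfolding bspec[OF g(2) a.generator_mem] by (rule h(2))
    \<comment> \<open>\<open>g\<close> is a homomorphism on a ring containing \<open>A\<close>, with
      values in \<open>F\<close> and hence in the whole field.\<close>
    moreover have "arithmetic_map R A g"
      unfolding arithmetic_map_def
    proof (intro conjI ballI impI)
      show "g \<in> A \<rightarrow> carrier R"
        using ring_hom_closed[OF g(1)] S(3) subfieldE(3)[OF F] by auto
      show "g \<one> = \<one>"
        using ring_hom_one[OF g(1)] by simp
      fix a b assume "a \<in> A" "b \<in> A"
      then have "a \<in> S" "b \<in> S"
        by (simp_all only: subsetD[OF S(3)])
      then show "g (a \<oplus> b) = g a \<oplus> g b" "g (a \<otimes> b) = g a \<otimes> g b"
        using ring_hom_add[OF g(1), of a b] ring_hom_mult[OF g(1), of a b] by simp_all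
    qed
    ultimately show False
      using A(4)[OF subset_refl, of g] by (elim notE)
  qed
qed

theorem theorem3:
  fixes K :: "('a, 'b) ring_scheme"
  assumes "field K"
    and "\<exists>F. subfield F K \<and> algebraically_closed (K\<lparr>carrier := F\<rparr>)"
  shows "fixed_elements K = prime_field K"
proof
  interpret field K by fact
  obtain F where F: "subfield F K" "algebraically_closed (K\<lparr>carrier := F\<rparr>)"
    using assms(2) by (elim exE conjE)
  show "prime_field K \<subseteq> fixed_elements K"
    by (rule prime_field_subset[OF subfield_fixed_elements])
  show "fixed_elements K \<subseteq> prime_field K"
  \<comment> \<open>The split is between positive characteristic and characteristic zero.\<close>
  proof (cases "\<exists>p::nat. 0 < p \<and> [p] \<cdot>\<^bsub>K\<^esub> \<one>\<^bsub>K\<^esub> = \<zero>\<^bsub>K\<^esub>")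
    case True
    then show ?thesis
      using fixed_elements_finite_char by (elim exE conjE)
  next
    case False
    then show ?thesis
      by (intro fixed_elements_char_zero[OF F]) blast
  qed
qed

end
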